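(* Let $n\in\mathbb{N}$, $n\ge1$, and let $Q\ge 1$. The monotonic rearrangement operator acts from $A_{2,Q}^d([0,1]^n)$ to $A_{2,Q'}([0,1])$ (that is, $\varphi^*\in A_{2,Q'}([0,1])$ for every $\varphi\in A_{2,Q}^d([0,1]^n)$) if and only if $$Q'\ \geq\ \frac{Q(2^n+1)^2-(2^n-1)^2}{2^{n+2}}.$$
   Context: For an integrable function $f$ and a set $I$ of positive finite Lebesgue measure, $\langle f\rangle_I=\frac{1}{|I|}\int_I f$. Let $\mathcal{D}$ be the set of all dyadic subcubes of $[0,1]^n$ (including $[0,1]^n$ itself). The dyadic Muckenhoupt class is $$A_{2,Q}^d([0,1]^n)=\Big\{\varphi\in L^1([0,1]^n)\colon \varphi>0,\ \sup_{I\in\mathcal{D}}\big(\langle\varphi\rangle_I\langle\varphi^{-1}\rangle_I\big)\le Q\Big\}.$$ The class $A_{2,Q}([0,1])$ is the set of positive functions $\varphi\in L^1([0,1])$ such that $\langle\varphi\rangle_I\langle\varphi^{-1}\rangle_I\le Q$ for all subintervals $I\subset[0,1]$. The monotonic rearrangement of a function $\varphi$ on $[0,1]^n$ is the monotone non-increasing function $\varphi^*$ on $[0,1]$ with the same distribution (with respect to Lebesgue measure) as $\varphi$. The (non-linear) operator $\varphi\mapsto\varphi^*$ is called the monotonic rearrangement operator. *)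

theory Defs
  imports "HOL-Probability.Probability"
begin

definition average :: "'a::euclidean_space set \<Rightarrow> ('a \<Rightarrow> real) \<Rightarrow> real" where
  "average I f = integral\<^sup>L (lebesgue_on I) f / measure lebesgue I"

abbreviation unit_cube :: "(real ^ 'n) set" where
  "unit_cube \<equiv> cbox 0 1"

definition dyadic_cubes :: "(real ^ 'n) set set" where
  "dyadic_cubes =
     {cbox (\<chi> i. real (j i) / 2 ^ k) (\<chi> i. (real (j i) + 1) / 2 ^ k) | (k :: nat) (j :: 'n \<Rightarrow> nat).
        \<forall>i. j i < 2 ^ k}"

text \<open>
  Weights are represented by real functions, only their values on the cube (the interval) matter,
  and, as for elements of \<open>L\<^sup>1\<close>, positivity is meant almost everywhere. The integrability of the
  reciprocal is required explicitly: the Bochner integral of a non-integrable function is \<open>0\<close>,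
  so the bound on the averages alone would hold trivially where the average of the reciprocal
  is infinite.
\<close>

definition dyadic_A2 :: "real \<Rightarrow> (real ^ 'n \<Rightarrow> real) set" where
  "dyadic_A2 Q =
     {\<phi>. integrable (lebesgue_on unit_cube) \<phi> \<and>
         (AE x in lebesgue_on unit_cube. 0 < \<phi> x) \<and>
         integrable (lebesgue_on unit_cube) (\<lambda>x. inverse (\<phi> x)) \<and>
         (\<forall>I\<in>dyadic_cubes. average I \<phi> * average I (\<lambda>x. inverse (\<phi> x)) \<le> Q)}"

definition interval_A2 :: "real \<Rightarrow> (real \<Rightarrow> real) set" where
  "interval_A2 Q =
     {\<phi>. integrable (lebesgue_on {0..1}) \<phi> \<and>
         (AE x in lebesgue_on {0..1}. 0 < \<phi> x) \<and>
         integrable (lebesgue_on {0..1}) (\<lambda>x. inverse (\<phi> x)) \<and>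
         (\<forall>a b. 0 \<le> a \<longrightarrow> a < b \<longrightarrow> b \<le> 1 \<longrightarrow>
            average {a..b} \<phi> * average {a..b} (\<lambda>x. inverse (\<phi> x)) \<le> Q)}"

text \<open>
  Monotonicity is required on the open interval because the rearrangement of an unbounded
  function is infinite at an end point. The rearrangement is determined up to a null set
  (its values at jumps and at the end points are free), see the two lemmas below.
\<close>

definition is_monotonic_rearrangement :: "(real ^ 'n \<Rightarrow> real) \<Rightarrow> (real \<Rightarrow> real) \<Rightarrow> bool" where
  "is_monotonic_rearrangement \<phi> \<psi> \<longleftrightarrow>
     antimono_on {0<..<1} \<psi> \<and>
     \<psi> \<in> borel_measurable (lebesgue_on {0..1}) \<and>
     distr (lebesgue_on {0..1}) borel \<psi> = distr (lebesgue_on unit_cube) borel \<phi>"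

definition monotonic_rearrangement :: "(real ^ 'n \<Rightarrow> real) \<Rightarrow> real \<Rightarrow> real" where
  "monotonic_rearrangement \<phi> = (SOME \<psi>. is_monotonic_rearrangement \<phi> \<psi>)"

lemma distr_reflect_unit_interval:
  "distr (restrict_space lborel {0<..<1::real}) (restrict_space borel {0<..<1}) (\<lambda>t. 1 - t)
     = restrict_space lborel {0<..<1}"
proof (rule measure_eqI)
  fix A assume "A \<in> sets (distr (restrict_space lborel {0<..<1::real})
    (restrict_space borel {0<..<1}) (\<lambda>t. 1 - t))"
  then have A: "A \<in> sets borel" "A \<subseteq> {0<..<1}"
    by (auto simp: sets_restrict_space)
  have m: "(\<lambda>t::real. 1 - t) \<in> restrict_space lborel {0<..<1} \<rightarrow>\<^sub>M restrict_space borel {0<..<1}"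
    by (intro measurable_restrict_space3) auto
  have A': "A \<in> sets (restrict_space borel {0<..<1})"
    using A by (auto simp: sets_restrict_space)
  have eq: "(\<lambda>t. 1 - t) -` A \<inter> space (restrict_space lborel {0<..<1}) = (\<lambda>t. 1 - t) -` A"
    using A by (auto simp: space_restrict_space)
  have "emeasure lborel A = emeasure (distr lborel borel (\<lambda>t. 1 + (-1) * t)) A"
    using lborel_real_affine[of "-1" 1] by (simp add: density_1)
  also have "\<dots> = emeasure lborel ((\<lambda>t. 1 - t) -` A)"
    using A by (subst emeasure_distr) auto
  finally have *: "emeasure lborel ((\<lambda>t. 1 - t) -` A) = emeasure lborel A" by simp
  show "emeasure (distr (restrict_space lborel {0<..<1::real}) (restrict_space borel {0<..<1}) (\<lambda>t. 1 - t)) A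
     = emeasure (restrict_space lborel {0<..<1}) A"
  proof -
    have "(\<lambda>t. 1 - t) -` A \<subseteq> {0<..<1}" using A by auto
    then show ?thesis
      using A * by (subst emeasure_distr[OF m A'], subst eq) (simp add: emeasure_restrict_space)
  qed
qed (auto simp: sets_restrict_space)

lemma ex_monotonic_rearrangement:
  fixes \<phi> :: "real ^ 'n \<Rightarrow> real"
  assumes \<phi>: "\<phi> \<in> borel_measurable (lebesgue_on unit_cube)"
  shows "\<exists>\<psi>. is_monotonic_rearrangement \<phi> \<psi>"
proof -
  let ?M = "distr (lebesgue_on unit_cube) borel \<phi>"
  let ?\<Omega> = "restrict_space lborel {0<..<1} :: real measure"
  have "emeasure lebesgue (unit_cube :: (real^'n) set) = 1"
    by (auto simp: emeasure_lborel_cbox_eq Basis_vec_def inner_axis intro!: prod.neutral)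
  then have "prob_space (lebesgue_on (unit_cube :: (real^'n) set))"
    by (intro prob_spaceI) (simp add: emeasure_restrict_space space_restrict_space)
  then interpret P: prob_space "lebesgue_on (unit_cube :: (real^'n) set)" .
  interpret M: cdf_distribution ?M
    using P.prob_space_distr[OF \<phi>] by (simp add: cdf_distribution_def real_distribution_def real_distribution_axioms_def)
  define \<psi> where "\<psi> t = (if t \<in> {0<..<1} then M.I (1 - t) else 0)" for t
  have m: "(\<lambda>t::real. 1 - t) \<in> ?\<Omega> \<rightarrow>\<^sub>M restrict_space borel {0<..<1}"
    by (intro measurable_restrict_space3) auto
  have dM: "distr ?\<Omega> borel (\<lambda>t. M.I (1 - t)) = ?M"
  proof -
    have "distr ?\<Omega> borel (\<lambda>t. M.I (1 - t)) =
        distr (distr ?\<Omega> (restrict_space borel {0<..<1}) (\<lambda>t. 1 - t)) borel M.I"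
      by (subst distr_distr[OF M.measurable_CI m]) (simp add: comp_def)
    then show ?thesis using M.distr_I_eq_M by (simp add: distr_reflect_unit_interval)
  qed
  have c: "(\<lambda>t. M.I (1 - t)) \<in> borel_measurable ?\<Omega>"
    by (rule measurable_compose[OF m M.measurable_CI])
  have mI: "(\<lambda>t. M.I (1 - t)) \<in> borel_measurable (restrict_space borel {0<..<1})"
    using c by (simp cong: measurable_cong_sets add: sets_restrict_space)
  have b: "\<psi> \<in> borel_measurable borel"
  proof -
    have "{t::real. t \<in> {0<..<1}} = {0<..<1}" by auto
    then show ?thesis
      unfolding \<psi>_def using mI by (subst measurable_If_restrict_space_iff) (simp_all del: greaterThanLessThan_iff)
  qed
  have am: "antimono_on {0<..<1} \<psi>"
    using M.mono_I by (auto simp: monotone_on_def \<psi>_def)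
  have bl: "\<psi> \<in> borel_measurable (lebesgue_on {0..1})"
    using b by (intro measurable_restrict_space1) (simp add: measurable_completion)
  have "distr (lebesgue_on {0..1}) borel \<psi> = distr ?\<Omega> borel (\<lambda>t. M.I (1 - t))"
  proof (rule measure_eqI)
    fix A assume "A \<in> sets (distr (lebesgue_on {0..1}) borel \<psi>)"
    then have A: "A \<in> sets borel" by simp
    have S: "\<psi> -` A \<in> sets borel" using b A by (metis measurable_sets_borel)
    have "emeasure (distr (lebesgue_on {0..1}) borel \<psi>) A = emeasure lebesgue (\<psi> -` A \<inter> {0..1})"
      using A bl by (simp add: emeasure_distr emeasure_restrict_space space_restrict_space)
    also have "\<dots> = emeasure lborel (\<psi> -` A \<inter> {0..1})"
      using S by simp
    also have "\<dots> = emeasure lborel (\<psi> -` A \<inter> {0<..<1})"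
      using S AE_lborel_singleton[of "0::real"] AE_lborel_singleton[of "1::real"]
      by (intro emeasure_eq_AE) (auto simp: less_le)
    also have "\<psi> -` A \<inter> {0<..<1} = (\<lambda>t. M.I (1 - t)) -` A \<inter> {0<..<1}"
      by (auto simp: \<psi>_def)
    also have "emeasure lborel \<dots> = emeasure (distr ?\<Omega> borel (\<lambda>t. M.I (1 - t))) A"
      using A c by (simp add: emeasure_distr emeasure_restrict_space space_restrict_space)
    finally show "emeasure (distr (lebesgue_on {0..1}) borel \<psi>) A =
      emeasure (distr ?\<Omega> borel (\<lambda>t. M.I (1 - t))) A" .
  qed simp
  with dM am bl show ?thesis
    unfolding is_monotonic_rearrangement_def by auto
qed

lemma monotonic_rearrangement_AE_unique:
  fixes \<phi> :: "real ^ 'n \<Rightarrow> real"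
  assumes 1: "is_monotonic_rearrangement \<phi> \<psi>" and 2: "is_monotonic_rearrangement \<phi> \<psi>'"
  shows "AE t in lebesgue_on {0..1}. \<psi> t = \<psi>' t"
proof -
  have le: "emeasure lebesgue {s \<in> {0..1}. c < f s} \<le> ennreal t"
    if "is_monotonic_rearrangement \<phi> f" "f t < c" "t \<in> {0<..<1}" for f c t
  proof -
    have "{s \<in> {0..1}. c < f s} \<subseteq> {0..t} \<union> {1}"
    proof
      fix s assume s: "s \<in> {s \<in> {0..1}. c < f s}"
      show "s \<in> {0..t} \<union> {1}"
      proof (rule ccontr)
        assume "s \<notin> {0..t} \<union> {1}"
        then have "t \<le> s" "s \<in> {0<..<1}" using s that(3) by auto
        then have "f s \<le> f t" using that unfolding is_monotonic_rearrangement_def monotone_on_def by blast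
        then show False using s that(2) by auto
      qed
    qed
    then have "emeasure lebesgue {s \<in> {0..1}. c < f s} \<le> emeasure lebesgue ({0..t} \<union> {1})"
      by (intro emeasure_mono) auto
    also have "\<dots> \<le> emeasure lebesgue {0..t} + emeasure lebesgue {1::real}"
      by (intro emeasure_subadditive) auto
    finally show ?thesis using that(3) by simp
  qed
  have ge: "ennreal t \<le> emeasure lebesgue {s \<in> {0..1}. c < f s}"
    if "is_monotonic_rearrangement \<phi> f" "c < f t" "t \<in> {0<..<1}" for f c t
  proof -
    have "{0<..t} \<subseteq> {s \<in> {0..1}. c < f s}"
    proof
      fix s assume s: "s \<in> {0<..t}"
      then have "s \<le> t" "s \<in> {0<..<1}" using that(3) by auto
      then have "f t \<le> f s" using that unfolding is_monotonic_rearrangement_def monotone_on_def by blast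
      then show "s \<in> {s \<in> {0..1}. c < f s}" using that s by auto
    qed
    moreover have "{s \<in> {0..1}. c < f s} \<in> sets lebesgue"
    proof -
      have "f \<in> borel_measurable (lebesgue_on {0..1})"
        using that(1) by (simp add: is_monotonic_rearrangement_def)
      then have "f -` {c<..} \<inter> space (lebesgue_on {0..1}) \<in> sets (lebesgue_on {0..1})"
        by (rule measurable_sets) simp
      moreover have "f -` {c<..} \<inter> space (lebesgue_on {0..1}) = {s \<in> {0..1}. c < f s}"
        by (auto simp: space_restrict_space)
      ultimately show ?thesis by (simp add: sets_restrict_space_iff)
    qed
    ultimately have "emeasure lebesgue {0<..t} \<le> emeasure lebesgue {s \<in> {0..1}. c < f s}"
      by (rule emeasure_mono)
    then show ?thesis using that(3) by simp
  qed
  define m where "m c = emeasure (distr (lebesgue_on unit_cube) borel \<phi>) {c<..}" for c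
  have m: "emeasure lebesgue {s \<in> {0..1}. c < f s} = m c"
    if "is_monotonic_rearrangement \<phi> f" for f c
  proof -
    have "m c = emeasure (distr (lebesgue_on {0..1}) borel f) {c<..}"
      using that by (simp add: m_def is_monotonic_rearrangement_def)
    also have "\<dots> = emeasure lebesgue (f -` {c<..} \<inter> {0..1})"
    proof -
      have "f \<in> borel_measurable (lebesgue_on {0..1})"
        using that by (simp add: is_monotonic_rearrangement_def)
      then show ?thesis
        by (simp add: emeasure_distr emeasure_restrict_space space_restrict_space)
    qed
    also have "f -` {c<..} \<inter> {0..1} = {s \<in> {0..1}. c < f s}" by auto
    finally show ?thesis by simp
  qed
  have key: "t \<in> (\<lambda>c. enn2real (m c)) ` \<rat>"
    if f: "is_monotonic_rearrangement \<phi> f" and g: "is_monotonic_rearrangement \<phi> g"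
      and t: "t \<in> {0<..<1}" and less: "f t < g t" for f g t
  proof -
    obtain c where c: "c \<in> \<rat>" "f t < c" "c < g t" using Rats_dense_in_real[OF less] by auto
    have "m c = ennreal t"
      using le[OF f c(2) t] ge[OF g c(3) t] m[OF f] m[OF g] by auto
    then have "t = enn2real (m c)" using t by simp
    then show ?thesis using c by blast
  qed
  let ?N = "(\<lambda>c. enn2real (m c)) ` \<rat> \<union> {0, 1}"
  have "?N \<in> null_sets lebesgue"
    by (intro countable_imp_null_set_lborel[THEN null_sets_completionI] countable_Un countable_image
        countable_rat) auto
  then have "AE t in lebesgue. t \<notin> ?N" by (rule AE_not_in)
  then have "AE t in lebesgue. t \<in> {0..1} \<longrightarrow> \<psi> t = \<psi>' t"
  proof eventually_elim
    case (elim t)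
    show ?case
    proof
      assume "t \<in> {0..1}"
      with elim have "t \<in> {0<..<1}" by (auto simp: less_le)
      then show "\<psi> t = \<psi>' t"
        using key[OF 1 2] key[OF 2 1] elim by (metis UnCI linorder_less_linear)
    qed
  qed
  then show ?thesis by (simp add: AE_restrict_space_iff)
qed

end

theory Submission
  imports Defs
begin

text \<open>
Let \<open>N = 2 ^ n\<close>. A weight \<open>\<phi>\<close> is followed down the tree of dyadic cubes through the points
\<open>x(I) = (average of \<phi> on I, average of 1/\<phi> on I)\<close> of the plane. They lie in the strip
\<open>1 \<le> x1 x2 \<le> Q\<close>, each of them is the mean of the points of its \<open>N\<close> subcubes, and in the limit they
approach the points \<open>(s, 1/s)\<close>, where \<open>s\<close> is a value of \<open>\<phi>\<close>.

The constant is the largest product that can occur on a segment from \<open>x(I)\<close> to the point of a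
subcube \<open>J\<close>. Indeed \<open>x(I)\<close> divides the segment from \<open>y\<close>, the mean of the other points, to \<open>x(J)\<close> in
the ratio \<open>1 : (N - 1)\<close>. The product is quadratic along this segment, at least \<open>1\<close> at \<open>y\<close> and at most
\<open>Q\<close> at \<open>x(I)\<close> and \<open>x(J)\<close>, so between \<open>x(I)\<close> and \<open>x(J)\<close> it is at most
\<open>1 + (Q - 1) (N + 1)^2 / (4 N)\<close>, which is the bound of the theorem (\<open>chord_product_bound\<close>).

Sufficiency. Let \<open>\<psi> \<ge> 1\<close> belong to the dyadic class and let \<open>R > 1\<close> be at least the constant. The
tangent from \<open>(1, 1)\<close> to the hyperbola \<open>x1 x2 = R\<close> has two disjoint pieces of the strip
\<open>1 \<le> x1 x2 \<le> R\<close> strictly above it, one on each side of the point of tangency. A segment in the strip cannot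
connect them, so the subcubes of a cube whose point is in the left piece have their points in the
left piece or below the tangent. Hence the height above the tangent, replaced by \<open>0\<close> outside the left
piece, does not decrease on average when one descends the tree (\<open>tangent_cap_le_mean\<close>). It vanishes
at all points \<open>(s, 1/s)\<close> with \<open>s \<ge> 1\<close>, so it vanishes at the point of the whole cube
(\<open>tangent_cap_average_eq_0\<close>); this limit uses Henstock's lemma for divisions into dyadic cubes that
are fine for a gauge. The conclusion amounts to a bound for the product of the averages of \<open>\<psi>\<close>
and \<open>1/\<psi>\<close> after any amount of mass with value \<open>1\<close> has been removed (\<open>dyadic_A2_bounded_below\<close>). Scaling and the
symmetry \<open>\<phi> \<mapsto> 1/\<phi>\<close> give the same for every lower and every upper bound of a weight.

Now take an interval \<open>[a, b]\<close> and truncate \<open>\<phi>\<close> at the values \<open>c = \<phi>*(b)\<close> and \<open>d = \<phi>*(a)\<close>. The class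
is stable under truncation, and the rearrangement of the truncated weight is constant on both sides
of \<open>[a, b]\<close>. Adding to \<open>[a, b]\<close> masses with the values \<open>c\<close> and \<open>d\<close> in the proportion that moves the
point of \<open>[a, b]\<close> along its ray from the origin only increases the product. One can add in this
proportion either all the mass with value \<open>d\<close> or all the mass with value \<open>c\<close>, and one of the two
one-sided bounds applies (\<open>product_le_of_one_sided_bounds\<close>).

Necessity. In the extremal case of the segment argument all points but one equal \<open>(1, 1)\<close>. Repeating
this configuration on smaller and smaller corner cubes gives the weight that is \<open>\<kappa>^k\<close> between the
corner cubes of side \<open>2^-k\<close> and \<open>2^-(k+1)\<close>. For a suitable \<open>\<kappa>\<close> the product of its averages is \<open>Q\<close> on
each corner cube and \<open>1\<close> on all other dyadic cubes, while its rearrangement has exactly the constant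
of the theorem as product of averages over \<open>[0, 2 / (N + 1)]\<close>.
\<close>

section \<open>The constant and the products along a segment\<close>

text \<open>
The bound of the theorem, in the form in which it arises in \<open>chord_product_bound\<close>.
\<close>

definition extension_constant :: "nat \<Rightarrow> real \<Rightarrow> real" where
  "extension_constant n Q = 1 + (Q - 1) * (2 ^ n + 1)^2 / (4 * 2 ^ n)"

lemma extension_constant_eq:
  "extension_constant n Q = (Q * (2 ^ n + 1)^2 - (2 ^ n - 1)^2) / 2 ^ (n + 2)"
  by (simp add: extension_constant_def field_simps power2_eq_square power_add)

lemma extension_constant_ge:
  assumes "1 \<le> Q" shows "Q \<le> extension_constant n Q"
proof -
  have "0 \<le> (2 ^ n - 1 :: real)^2" by simp
  then have "1 \<le> ((2 ^ n + 1)^2 / (4 * 2 ^ n) :: real)" by (simp add: field_simps power2_eq_square)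
  then have "(Q - 1) * 1 \<le> (Q - 1) * ((2 ^ n + 1)^2 / (4 * 2 ^ n))" using assms by (intro mult_left_mono) auto
  then show ?thesis by (simp add: extension_constant_def)
qed

text \<open>
The product is a quadratic function \<open>f\<close> of \<open>s\<close>. Lagrange interpolation at \<open>0\<close>, \<open>1/N\<close> and \<open>1\<close> writes
\<open>f s\<close>, for \<open>1/N \<le> s \<le> 1\<close>, with a nonpositive coefficient of \<open>f 0 \<ge> 1\<close> and nonnegative ones of
\<open>f (1/N) \<le> Q\<close> and \<open>f 1 \<le> Q\<close>. The extremal case \<open>f 0 = 1\<close>, \<open>f (1/N) = f 1 = Q\<close> has its maximum at
\<open>s = (N + 1) / (2 N)\<close>.
\<close>

lemma chord_product_bound:
  fixes N Q s y1 y2 e1 e2 :: real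
  assumes N: "2 \<le> N" and Q: "1 \<le> Q" and y: "1 \<le> y1 * y2" and e: "e1 * e2 \<le> Q"
    and x: "(y1 + (e1 - y1) / N) * (y2 + (e2 - y2) / N) \<le> Q"
    and s: "1 / N \<le> s" "s \<le> 1"
  shows "(y1 + s * (e1 - y1)) * (y2 + s * (e2 - y2)) \<le> 1 + (Q - 1) * (N + 1)^2 / (4 * N)"
proof -
  define f where "f \<sigma> = (y1 + \<sigma> * (e1 - y1)) * (y2 + \<sigma> * (e2 - y2))" for \<sigma>
  have sN: "1 \<le> s * N" using s N by (simp add: field_simps)
  have s0: "0 \<le> s" using N by (intro order_trans[OF _ s(1)]) simp
  have fx: "f (1/N) \<le> Q" using x by (simp add: f_def field_simps)
  have id: "(N - 1) * f s = (N - 1) * (1 - s) * (1 - s * N) * (y1 * y2)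
      + s * (1 - s) * N^2 * f (1/N) + s * (s * N - 1) * (e1 * e2)"
    using N by (simp add: f_def field_simps power2_eq_square)
  have c0: "(N - 1) * (1 - s) * (1 - s * N) \<le> 0"
    using N s sN by (intro mult_nonneg_nonpos) auto
  have c1: "0 \<le> s * (1 - s) * N^2" using s s0 N by (intro mult_nonneg_nonneg) auto
  have c2: "0 \<le> s * (s * N - 1)" using s s0 N sN by (intro mult_nonneg_nonneg) auto
  have "(N - 1) * f s \<le> (N - 1) * (1 - s) * (1 - s * N) * 1 + s * (1 - s) * N^2 * Q + s * (s * N - 1) * Q"
    unfolding id
    by (intro add_mono mult_left_mono_neg[OF y c0] mult_left_mono[OF fx c1] mult_left_mono[OF e c2])
  also have "\<dots> = (N - 1) * (1 + (Q - 1) * (s + N * s - N * s^2))"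
    by (simp add: algebra_simps power2_eq_square)
  finally have "f s \<le> 1 + (Q - 1) * (s + N * s - N * s^2)"
    using N by (simp add: mult_le_cancel_left)
  moreover have "s + N * s - N * s^2 \<le> (N + 1)^2 / (4 * N)"
  proof -
    have "0 \<le> (2 * N * s - (N + 1))^2" by simp
    then have "4 * N * (s + N * s - N * s^2) \<le> (N + 1)^2"
      by (simp add: algebra_simps power2_eq_square)
    then show ?thesis using N by (simp add: pos_le_divide_eq mult.commute)
  qed
  then have "(Q - 1) * (s + N * s - N * s^2) \<le> (Q - 1) * ((N + 1)^2 / (4 * N))"
    using Q by (intro mult_left_mono) auto
  ultimately show ?thesis by (simp add: f_def)
qed

lemma sum_two_le_of_product_ge_one:
  fixes a b :: real
  assumes "0 < a" "0 < b" "1 \<le> a * b"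
  shows "2 \<le> a + b"
proof -
  have "0 \<le> (a - b)^2" by simp
  then have "4 * (a * b) \<le> (a + b)^2" by (simp add: power2_eq_square algebra_simps)
  then have "2^2 \<le> (a + b)^2" using assms by simp
  then show ?thesis using assms by (intro power2_le_imp_le[of 2 "a + b"]) auto
qed

text \<open>
The region \<open>a * b \<ge> 1\<close> of the positive quadrant is convex, so the mean of points in it is in it.
\<close>

lemma product_of_sums_ge:
  fixes a b :: "'e \<Rightarrow> real"
  assumes F: "finite F" "F \<noteq> {}" and p: "\<And>e. e \<in> F \<Longrightarrow> 0 < a e \<and> 0 < b e \<and> 1 \<le> a e * b e"
  shows "(real (card F))^2 \<le> sum a F * sum b F"
proof -
  define m y where "m = real (card F)" and "y = sum a F / m"
  have m: "0 < m" using F by (simp add: card_gt_0_iff m_def)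
  have y: "0 < y" using F p m by (auto simp: y_def intro!: divide_pos_pos sum_pos)
  have "(\<Sum>e\<in>F. 2) \<le> (\<Sum>e\<in>F. a e / y + b e * y)"
  proof (rule sum_mono)
    fix e assume e: "e \<in> F"
    have "1 \<le> (a e / y) * (b e * y)" using p[OF e] y by simp
    then show "2 \<le> a e / y + b e * y"
      using p[OF e] y by (intro sum_two_le_of_product_ge_one) auto
  qed
  also have "\<dots> = sum a F / y + sum b F * y"
    by (simp add: sum.distrib sum_distrib_right sum_divide_distrib)
  also have "sum a F / y = m" using y m by (auto simp: y_def)
  finally have "m \<le> sum b F * y" by (simp add: m_def)
  then have "m \<le> sum b F * sum a F / m" by (simp add: y_def)
  then show ?thesis using m by (simp add: pos_le_divide_eq power2_eq_square mult.commute m_def)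
qed

text \<open>
The linear function \<open>(1 - r) x1 + (1 + r) x2 - 2\<close> vanishes on the tangent from \<open>(1, 1)\<close> to the
hyperbola \<open>x1 x2 = 1 / (1 - r^2)\<close> with point of tangency \<open>(1 / (1 - r), 1 / (1 + r))\<close>. The function
below is its positive part on the left of the point of tangency, and \<open>0\<close> on the right of it. In the
coordinates \<open>p = (1 - r) x1\<close>, \<open>q = (1 + r) x2\<close> the hyperbola is \<open>p q = 1\<close>, the tangent is
\<open>p + q = 2\<close> and the point of tangency is \<open>(1, 1)\<close>.
\<close>

definition tangent_cap :: "real \<Rightarrow> real \<Rightarrow> real \<Rightarrow> real" where
  "tangent_cap r x1 x2 = (if (1 - r) * x1 < 1 then max 0 ((1 - r) * x1 + (1 + r) * x2 - 2) else 0)"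

lemma tangent_cap_nonneg: "0 \<le> tangent_cap r x1 x2"
  by (simp add: tangent_cap_def)

text \<open>
Only a mean \<open>(A, B)\<close> in the left piece above the tangent needs an argument. There the function is
linear, and at the points \<open>(a e, b e)\<close> it can be smaller than the linear function only to the right
of the point of tangency and above the tangent. But then the segment from \<open>(A, B)\<close> to \<open>(a e, b e)\<close>
would stay above the tangent and cross the line \<open>x1 = 1 / (1 - r)\<close>, where the product exceeds
\<open>1 / (1 - r^2)\<close>; this contradicts \<open>chord_product_bound\<close>.
\<close>

lemma tangent_cap_le_mean:
  fixes a b :: "'e \<Rightarrow> real"
  assumes r: "0 < r" "r < 1" and F: "finite F" "2 \<le> card F" and Q: "1 \<le> Q"
    and R: "1 + (Q - 1) * (real (card F) + 1)^2 / (4 * real (card F)) \<le> 1 / (1 - r^2)"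
    and p: "\<And>e. e \<in> F \<Longrightarrow> 0 < a e \<and> 0 < b e \<and> 1 \<le> a e * b e \<and> a e * b e \<le> Q"
    and A: "A = sum a F / card F" and B: "B = sum b F / card F" and AB: "A * B \<le> Q"
  shows "tangent_cap r A B \<le> (\<Sum>e\<in>F. tangent_cap r (a e) (b e)) / card F"
proof (cases "(1 - r) * A < 1 \<and> 2 < (1 - r) * A + (1 + r) * B")
  case False
  then have "tangent_cap r A B = 0" by (auto simp: tangent_cap_def)
  then show ?thesis by (simp add: sum_nonneg tangent_cap_nonneg)
next
  case True
  define N where "N = real (card F)"
  have N: "2 \<le> N" using F by (simp add: N_def)
  define L where "L x1 x2 = (1 - r) * x1 + (1 + r) * x2 - 2" for x1 x2
  have L0: "0 < L A B" using True by (simp add: L_def)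
  have main: "L (a e) (b e) \<le> tangent_cap r (a e) (b e)" if e: "e \<in> F" for e
  proof (cases "(1 - r) * a e < 1 \<or> L (a e) (b e) \<le> 0")
    case True
    then show ?thesis by (auto simp: tangent_cap_def L_def)
  next
    case False
    define y1 y2 where "y1 = sum a (F - {e}) / (N - 1)" and "y2 = sum b (F - {e}) / (N - 1)"
    have cF: "card (F - {e}) = card F - 1" using F e by (simp add: card_Diff_singleton)
    then have "0 < card (F - {e})" using F by simp
    then have ne: "F - {e} \<noteq> {}" by (metis card.empty less_irrefl)
    have "real (card (F - {e})) = N - 1" unfolding cF using F by (simp add: N_def of_nat_diff)
    then have "(N - 1)^2 \<le> sum a (F - {e}) * sum b (F - {e})"
      using product_of_sums_ge[of "F - {e}" a b] F p ne by auto
    moreover have "y1 * y2 = sum a (F - {e}) * sum b (F - {e}) / (N - 1)^2"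
      by (simp add: y1_def y2_def power2_eq_square)
    ultimately have y: "1 \<le> y1 * y2" using N by (simp only: le_divide_eq_1) simp
    have "sum a F = a e + sum a (F - {e})" "sum b F = b e + sum b (F - {e})"
      using F e by (simp_all add: sum.remove)
    then have "N * A = a e + (N - 1) * y1" "N * B = b e + (N - 1) * y2"
      using N by (simp_all add: A B N_def[symmetric] y1_def y2_def)
    then have A': "A = y1 + (a e - y1) / N" and B': "B = y2 + (b e - y2) / N"
      using N by (simp_all add: field_simps)
    \<comment> \<open>the parameter at which the segment from \<open>(A, B)\<close> to \<open>(a e, b e)\<close> meets \<open>x1 = 1 / (1 - r)\<close>\<close>
    define \<tau> where "\<tau> = (1 - (1 - r) * A) / ((1 - r) * a e - (1 - r) * A)"
    have d: "(1 - r) * A < 1" "1 \<le> (1 - r) * a e" using True False by auto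
    have \<tau>: "0 \<le> \<tau>" "\<tau> \<le> 1" using d by (auto simp: \<tau>_def divide_simps)
    define z1 z2 where "z1 = A + \<tau> * (a e - A)" and "z2 = B + \<tau> * (b e - B)"
    have "(1 - r) * z1 = (1 - r) * A + \<tau> * ((1 - r) * a e - (1 - r) * A)"
      by (simp add: z1_def algebra_simps)
    also have "\<tau> * ((1 - r) * a e - (1 - r) * A) = 1 - (1 - r) * A"
    proof -
      have "(1 - r) * a e - (1 - r) * A \<noteq> 0" using d by linarith
      then show ?thesis unfolding \<tau>_def by (rule nonzero_divide_eq_eq[THEN iffD1, OF _ refl, symmetric])
    qed
    also have "(1 - r) * A + (1 - (1 - r) * A) = 1" by simp
    finally have z1: "(1 - r) * z1 = 1" .
    have "L z1 z2 = (1 - \<tau>) * L A B + \<tau> * L (a e) (b e)"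
      by (simp add: L_def z1_def z2_def algebra_simps)
    moreover have "0 < \<dots>"
    proof (cases "\<tau> = 1")
      case True then show ?thesis using False by simp
    next
      case F1: False
      then have "0 < (1 - \<tau>) * L A B" using \<tau> L0 by (intro mult_pos_pos) auto
      moreover have "0 \<le> \<tau> * L (a e) (b e)" using \<tau> False by (intro mult_nonneg_nonneg) auto
      ultimately show ?thesis by linarith
    qed
    ultimately have z2: "1 < (1 + r) * z2" using z1 by (simp add: L_def)
    have "1 < ((1 - r) * z1) * ((1 + r) * z2)" using z1 z2 by simp
    also have "\<dots> = (1 - r^2) * (z1 * z2)" by (simp add: algebra_simps power2_eq_square)
    finally have big: "1 / (1 - r^2) < z1 * z2"
    proof -
      assume *: "1 < (1 - r^2) * (z1 * z2)"
      have "r^2 < 1" using r by (simp add: power_less_one_iff)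
      then show ?thesis using * by (simp add: divide_less_eq mult.commute)
    qed
    \<comment> \<open>the same point in the parametrization of the longer segment from \<open>(y1, y2)\<close> to \<open>(a e, b e)\<close>\<close>
    define s where "s = 1 / N + \<tau> * (1 - 1 / N)"
    have s: "1 / N \<le> s" "s \<le> 1"
    proof -
      have "0 \<le> 1 - 1 / N" using N by simp
      then show "1 / N \<le> s" "s \<le> 1"
        using \<tau> mult_right_mono[of \<tau> 1 "1 - 1/N"] by (auto simp: s_def)
    qed
    have gen: "X + \<tau> * (x - X) = y + s * (x - y)" if "X = y + (x - y) / N" for X x y
    proof -
      have "X + \<tau> * (x - X) = (1 - \<tau>) * X + \<tau> * x" by (simp add: algebra_simps)
      also have "\<dots> = y + s * (x - y)" unfolding that s_def by (simp add: algebra_simps diff_divide_distrib)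
      finally show ?thesis .
    qed
    have "z1 = y1 + s * (a e - y1)" "z2 = y2 + s * (b e - y2)"
      unfolding z1_def z2_def by (rule gen[OF A'], rule gen[OF B'])
    moreover have "(y1 + s * (a e - y1)) * (y2 + s * (b e - y2)) \<le> 1 + (Q - 1) * (N + 1)^2 / (4 * N)"
      using chord_product_bound[OF N Q y, of "a e" "b e" s] p[OF e] AB s unfolding A'[symmetric] B'[symmetric] by blast
    ultimately have "z1 * z2 \<le> 1 / (1 - r^2)" using R by (simp add: N_def)
    with big show ?thesis by simp
  qed
  have c: "real (card F) \<noteq> 0" using F by auto
  have "tangent_cap r A B = L A B" using True by (simp add: tangent_cap_def L_def)
  also have "\<dots> = (\<Sum>e\<in>F. L (a e) (b e)) / card F"
    using c unfolding L_def A B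
    by (simp add: sum.distrib sum_subtractf sum_distrib_left[symmetric] add_divide_distrib diff_divide_distrib)
  also have "\<dots> \<le> (\<Sum>e\<in>F. tangent_cap r (a e) (b e)) / card F"
    by (intro divide_right_mono sum_mono main) auto
  finally show ?thesis .
qed

text \<open>
If \<open>(s, 1/s)\<close> is on or below the tangent, this is the Lipschitz estimate of the linear function.
Otherwise \<open>s \<ge> (1 + r) / (1 - r)\<close>, and then \<open>(s, 1/s)\<close> is far to the right of the left piece.
\<close>

lemma tangent_cap_le_distance:
  assumes r: "0 < r" "r < 1" and s: "1 \<le> s" and x: "x2 \<le> 1"
  shows "tangent_cap r x1 x2 \<le> 2 * (\<bar>x1 - s\<bar> + \<bar>x2 - inverse s\<bar>)"
proof (cases "(1 - r) * x1 < 1 \<and> 0 < (1 - r) * x1 + (1 + r) * x2 - 2")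
  case False
  then have "tangent_cap r x1 x2 = 0" by (auto simp: tangent_cap_def)
  then show ?thesis by simp
next
  case True
  then have c: "tangent_cap r x1 x2 = (1 - r) * x1 + (1 + r) * x2 - 2" by (simp add: tangent_cap_def)
  show ?thesis
  proof (cases "(1 - r) * s \<le> 1 + r")
    case s': True
    have "((1 - r) * s - (1 + r)) * (s - 1) \<le> 0" using s s' by (intro mult_nonpos_nonneg) auto
    then have "(1 - r) * s + (1 + r) * inverse s - 2 \<le> 0" using s by (simp add: field_simps)
    then have "tangent_cap r x1 x2 \<le> (1 - r) * (x1 - s) + (1 + r) * (x2 - inverse s)"
      unfolding c by (simp add: algebra_simps)
    also have "\<dots> \<le> 2 * \<bar>x1 - s\<bar> + 2 * \<bar>x2 - inverse s\<bar>"
    proof (rule add_mono)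
      have "(1 - r) * (x1 - s) \<le> \<bar>(1 - r) * (x1 - s)\<bar>" by simp
      also have "\<dots> \<le> 2 * \<bar>x1 - s\<bar>" using r by (simp add: abs_mult mult_right_mono)
      finally show "(1 - r) * (x1 - s) \<le> 2 * \<bar>x1 - s\<bar>" .
      have "(1 + r) * (x2 - inverse s) \<le> \<bar>(1 + r) * (x2 - inverse s)\<bar>" by simp
      also have "\<dots> \<le> 2 * \<bar>x2 - inverse s\<bar>" using r by (simp add: abs_mult mult_right_mono)
      finally show "(1 + r) * (x2 - inverse s) \<le> 2 * \<bar>x2 - inverse s\<bar>" .
    qed
    finally show ?thesis by simp
  next
    case s': False
    have "(1 + r) * x2 \<le> 1 + r" using mult_left_mono[OF x, of "1 + r"] r by simp
    then have "tangent_cap r x1 x2 \<le> r" using True c by linarith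
    also have "r \<le> (1 - r) * (s - x1)" using s' True by (simp add: algebra_simps)
    also have "\<dots> \<le> \<bar>(1 - r) * (s - x1)\<bar>" by simp
    also have "\<dots> \<le> 2 * \<bar>x1 - s\<bar>" using r by (simp add: abs_mult mult_right_mono abs_minus_commute)
    finally show ?thesis by (rule order_trans) simp
  qed
qed

section \<open>Dyadic cubes and fine dyadic divisions\<close>

definition dyadic_cube :: "nat \<Rightarrow> ('n \<Rightarrow> nat) \<Rightarrow> (real ^ 'n) set" where
  "dyadic_cube k j = cbox (\<chi> i. real (j i) / 2 ^ k) (\<chi> i. (real (j i) + 1) / 2 ^ k)"

text \<open>
The \<open>2^n\<close> halves of the dyadic cube \<open>(k, j)\<close> are the dyadic cubes \<open>(k + 1, subcube j e)\<close>, where \<open>e\<close>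
tells in which coordinates the upper half is taken.
\<close>

definition subcube :: "('n \<Rightarrow> nat) \<Rightarrow> ('n \<Rightarrow> bool) \<Rightarrow> 'n \<Rightarrow> nat" where
  "subcube j e = (\<lambda>i. 2 * j i + of_bool (e i))"

lemma dyadic_cubes_eq: "dyadic_cubes = {dyadic_cube k j | k j. \<forall>i. j i < 2 ^ k}"
  by (simp add: dyadic_cubes_def dyadic_cube_def)

lemma unit_cube_eq: "unit_cube = dyadic_cube 0 (\<lambda>_. 0)"
  by (simp add: dyadic_cube_def zero_vec_def one_vec_def)

lemma mem_dyadic_cube:
  "x \<in> dyadic_cube k j \<longleftrightarrow> (\<forall>i. real (j i) \<le> x $ i * 2 ^ k \<and> x $ i * 2 ^ k \<le> real (j i) + 1)"
  by (auto simp: dyadic_cube_def mem_box_cart field_simps)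

lemma mem_interior_dyadic_cube:
  "x \<in> interior (dyadic_cube k j) \<longleftrightarrow> (\<forall>i. real (j i) < x $ i * 2 ^ k \<and> x $ i * 2 ^ k < real (j i) + 1)"
  by (auto simp: dyadic_cube_def interior_cbox mem_box_cart field_simps)

lemma center_in_interior_dyadic_cube: "(\<chi> i. (real (j i) + 1/2) / 2 ^ k) \<in> interior (dyadic_cube k j)"
  by (simp add: mem_interior_dyadic_cube)

lemma dyadic_cube_nonempty: "dyadic_cube k j \<noteq> {}"
  using center_in_interior_dyadic_cube[of j k] interior_subset by fastforce

lemma measure_dyadic_cube: "measure lebesgue (dyadic_cube k (j :: 'n::finite \<Rightarrow> nat)) = 1 / (2 ^ CARD('n)) ^ k"
proof -
  have "measure lebesgue (dyadic_cube k j) = (\<Prod>i\<in>(UNIV::'n set). 1 / 2 ^ k)"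
    using dyadic_cube_nonempty[of k j] unfolding dyadic_cube_def
    by (simp add: content_cbox_cart add_divide_distrib)
  then show ?thesis by (simp add: power_divide power_mult[symmetric] mult.commute)
qed

lemma subcube_less: "\<forall>i. j i < 2 ^ k \<Longrightarrow> \<forall>i. subcube j e i < 2 ^ Suc k"
proof
  fix i assume "\<forall>i. j i < 2 ^ k"
  then have "j i + 1 \<le> 2 ^ k" by (simp add: Suc_le_eq)
  then show "subcube j e i < 2 ^ Suc k" by (auto simp: subcube_def of_bool_def)
qed

lemma subcube_subset: "dyadic_cube (Suc k) (subcube j e) \<subseteq> dyadic_cube k j"
proof
  fix x assume x: "x \<in> dyadic_cube (Suc k) (subcube j e)"
  show "x \<in> dyadic_cube k j"
    unfolding mem_dyadic_cube
  proof
    fix i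
    have "real (2 * j i + of_bool (e i)) \<le> x $ i * 2 ^ Suc k" "x $ i * 2 ^ Suc k \<le> real (2 * j i + of_bool (e i)) + 1"
      using x unfolding mem_dyadic_cube subcube_def by auto
    then show "real (j i) \<le> x $ i * 2 ^ k \<and> x $ i * 2 ^ k \<le> real (j i) + 1" by (cases "e i") auto
  qed
qed

lemma subcubes_disjoint:
  assumes "e \<noteq> e'"
  shows "interior (dyadic_cube (Suc k) (subcube j e)) \<inter> interior (dyadic_cube (Suc k) (subcube j e')) = {}"
proof -
  obtain i where i: "e i \<noteq> e' i" using assms by auto
  have False if "x \<in> interior (dyadic_cube (Suc k) (subcube j e))" "x \<in> interior (dyadic_cube (Suc k) (subcube j e'))" for x
  proof -
    have "real (subcube j e i) < x $ i * 2 ^ Suc k" "x $ i * 2 ^ Suc k < real (subcube j e i) + 1"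
      "real (subcube j e' i) < x $ i * 2 ^ Suc k" "x $ i * 2 ^ Suc k < real (subcube j e' i) + 1"
      using that unfolding mem_interior_dyadic_cube by auto
    then show False using i by (cases "e i"; cases "e' i") (auto simp: subcube_def)
  qed
  then show ?thesis by blast
qed

lemma inj_subcubes: "inj (\<lambda>e. dyadic_cube (Suc k) (subcube j e))"
proof (rule injI, rule ccontr)
  fix e e' assume *: "dyadic_cube (Suc k) (subcube j e) = dyadic_cube (Suc k) (subcube j e')" "e \<noteq> e'"
  show False using subcubes_disjoint[OF *(2), of k j] center_in_interior_dyadic_cube[of "subcube j e" "Suc k"] *(1) by auto
qed

lemma Union_subcubes: "(\<Union>e. dyadic_cube (Suc k) (subcube j e)) = dyadic_cube k j"
proof
  show "(\<Union>e. dyadic_cube (Suc k) (subcube j e)) \<subseteq> dyadic_cube k j" using subcube_subset by blast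
  show "dyadic_cube k j \<subseteq> (\<Union>e. dyadic_cube (Suc k) (subcube j e))"
  proof
    fix x assume x: "x \<in> dyadic_cube k j"
    have "x \<in> dyadic_cube (Suc k) (subcube j (\<lambda>i. 2 * real (j i) + 1 \<le> x $ i * 2 ^ Suc k))"
      unfolding mem_dyadic_cube
    proof
      fix i
      have "real (j i) \<le> x $ i * 2 ^ k" "x $ i * 2 ^ k \<le> real (j i) + 1" using x unfolding mem_dyadic_cube by auto
      then show "real (subcube j (\<lambda>i. 2 * real (j i) + 1 \<le> x $ i * 2 ^ Suc k) i) \<le> x $ i * 2 ^ Suc k \<and>
          x $ i * 2 ^ Suc k \<le> real (subcube j (\<lambda>i. 2 * real (j i) + 1 \<le> x $ i * 2 ^ Suc k) i) + 1"
        by (auto simp: subcube_def of_bool_def)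
    qed
    then show "x \<in> (\<Union>e. dyadic_cube (Suc k) (subcube j e))" by blast
  qed
qed

lemma subcubes_division_of:
  "range (\<lambda>e. dyadic_cube (Suc k) (subcube j e)) division_of dyadic_cube k (j :: 'n::finite \<Rightarrow> nat)"
proof (rule division_ofI)
  show "finite (range (\<lambda>e. dyadic_cube (Suc k) (subcube j e)))" by simp
next
  fix K assume "K \<in> range (\<lambda>e. dyadic_cube (Suc k) (subcube j e))"
  then obtain e where "K = dyadic_cube (Suc k) (subcube j e)" by auto
  then show "K \<subseteq> dyadic_cube k j" "K \<noteq> {}" "\<exists>a b. K = cbox a b"
    using subcube_subset[of k j e] dyadic_cube_nonempty[of "Suc k" "subcube j e"] unfolding dyadic_cube_def by blast+
next
  fix K1 K2
  assume "K1 \<in> range (\<lambda>e. dyadic_cube (Suc k) (subcube j e))" "K2 \<in> range (\<lambda>e. dyadic_cube (Suc k) (subcube j e))" "K1 \<noteq> K2"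
  then obtain e1 e2 where "K1 = dyadic_cube (Suc k) (subcube j e1)" "K2 = dyadic_cube (Suc k) (subcube j e2)" "e1 \<noteq> e2"
    by auto
  then show "interior K1 \<inter> interior K2 = {}" using subcubes_disjoint[of e1 e2] by simp
next
  show "\<Union> (range (\<lambda>e. dyadic_cube (Suc k) (subcube j e))) = dyadic_cube k j" by (rule Union_subcubes)
qed

lemma integral_subcubes:
  fixes f :: "real ^ 'n \<Rightarrow> real"
  assumes "f integrable_on dyadic_cube k j"
  shows "integral (dyadic_cube k j) f = (\<Sum>e\<in>UNIV. integral (dyadic_cube (Suc k) (subcube j e)) f)"
  using integral_combine_division_topdown[OF assms subcubes_division_of]
  by (simp add: sum.reindex[OF inj_subcubes] o_def)

lemma dyadic_cube_small:
  fixes x y :: "real ^ 'n"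
  assumes "x \<in> dyadic_cube k j" "y \<in> dyadic_cube k j"
  shows "dist x y \<le> real CARD('n) / 2 ^ k"
proof -
  have "\<bar>(x - y) $ i\<bar> \<le> 1 / 2 ^ k" for i
  proof -
    have "real (j i) \<le> x $ i * 2 ^ k" "x $ i * 2 ^ k \<le> real (j i) + 1"
      "real (j i) \<le> y $ i * 2 ^ k" "y $ i * 2 ^ k \<le> real (j i) + 1"
      using assms unfolding mem_dyadic_cube by auto
    then have "\<bar>x $ i * 2 ^ k - y $ i * 2 ^ k\<bar> \<le> 1" by linarith
    also have "x $ i * 2 ^ k - y $ i * 2 ^ k = (x - y) $ i * 2 ^ k" by (simp add: algebra_simps)
    finally have "\<bar>(x - y) $ i\<bar> * 2 ^ k \<le> 1" by (simp add: abs_mult)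
    then show ?thesis by (simp add: pos_le_divide_eq)
  qed
  then have "(\<Sum>i\<in>UNIV. \<bar>(x - y) $ i\<bar>) \<le> (\<Sum>i\<in>(UNIV::'n set). 1 / 2 ^ k)" by (intro sum_mono)
  then show ?thesis unfolding dist_norm using norm_le_l1_cart[of "x - y"] by simp
qed

lemma closed_dyadic_cube: "closed (dyadic_cube k j)"
  by (simp add: dyadic_cube_def closed_cbox)

text \<open>
A cube for which the conclusion fails has a subcube for which it fails, because the divisions of the
subcubes could be put together. The nested sequence of bad cubes obtained in this way shrinks to a
point, and eventually its cubes are fine for the gauge with this point as tag. Such a cube on its own
is a division of the required kind.
\<close>

lemma dyadic_fine_division:
  fixes \<Psi> :: "(real ^ 'n) set \<Rightarrow> real" and j :: "'n \<Rightarrow> nat"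
  assumes \<gamma>: "gauge \<gamma>" and j: "\<forall>i. j i < 2 ^ k"
    and sub: "\<And>k j. \<forall>i. j i < 2 ^ k \<Longrightarrow>
      \<Psi> (dyadic_cube k j) \<le> (\<Sum>e\<in>UNIV. \<Psi> (dyadic_cube (Suc k) (subcube j e)))"
  shows "\<exists>p. p tagged_division_of dyadic_cube k j \<and> \<gamma> fine p \<and> snd ` p \<subseteq> dyadic_cubes \<and>
    \<Psi> (dyadic_cube k j) \<le> (\<Sum>(x, K)\<in>p. \<Psi> K)"
proof (rule ccontr)
  define good where "good k j p \<longleftrightarrow> p tagged_division_of dyadic_cube k j \<and> \<gamma> fine p \<and>
    snd ` p \<subseteq> dyadic_cubes \<and> \<Psi> (dyadic_cube k j) \<le> (\<Sum>(x, K)\<in>p. \<Psi> K)" for k p and j :: "'n \<Rightarrow> nat"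
  assume "\<not> ?thesis"
  then have bad: "\<nexists>p. good k j p" by (simp add: good_def)
  have step: "\<exists>p. good m l p" if l: "\<forall>i. l i < 2 ^ m" and ch: "\<And>e. \<exists>p. good (Suc m) (subcube l e) p" for m and l :: "'n \<Rightarrow> nat"
  proof -
    obtain P where P: "\<And>e. good (Suc m) (subcube l e) (P e)" using ch by metis
    let ?c = "\<lambda>e. dyadic_cube (Suc m) (subcube l e)"
    let ?q = "\<lambda>K. P (inv ?c K)"
    have inv: "inv ?c (?c e) = e" for e by (rule inv_f_f[OF inj_subcubes])
    have un: "\<Union> (?q ` range ?c) = (\<Union>e. P e)" by (simp add: image_image inv)
    have "\<Union> (?q ` range ?c) tagged_division_of \<Union> (range ?c)"
    proof (rule tagged_division_Union)
      fix K assume "K \<in> range ?c"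
      then show "?q K tagged_division_of K" using P by (auto simp: inv good_def)
    next
      fix K1 K2 assume "K1 \<in> range ?c" "K2 \<in> range ?c" "K1 \<noteq> K2"
      then obtain e1 e2 where "K1 = ?c e1" "K2 = ?c e2" "e1 \<noteq> e2" by auto
      then show "interior K1 \<inter> interior K2 = {}" using subcubes_disjoint[of e1 e2] by simp
    qed simp
    then have td: "(\<Union>e. P e) tagged_division_of dyadic_cube m l" unfolding un Union_subcubes .
    have fin: "finite (P e)" for e using P[of e] tagged_division_ofD(1) unfolding good_def by blast
    have disj: "P e \<inter> P e' = {}" if "e \<noteq> e'" for e e'
    proof (rule ccontr)
      assume "P e \<inter> P e' \<noteq> {}"
      then obtain x K where K: "(x, K) \<in> P e" "(x, K) \<in> P e'" by auto
      have "K \<subseteq> ?c e" "K \<subseteq> ?c e'" using K P tagged_division_ofD(3) unfolding good_def by blast+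
      then have "interior K \<subseteq> interior (?c e) \<inter> interior (?c e')" by (simp add: interior_mono)
      moreover have "K \<in> dyadic_cubes" using K P unfolding good_def by force
      then have "interior K \<noteq> {}" using center_in_interior_dyadic_cube unfolding dyadic_cubes_eq by fastforce
      ultimately show False using subcubes_disjoint[OF that] by blast
    qed
    have "\<Psi> (dyadic_cube m l) \<le> (\<Sum>e\<in>UNIV. \<Psi> (?c e))" by (rule sub[OF l])
    also have "\<dots> \<le> (\<Sum>e\<in>UNIV. \<Sum>(x, K)\<in>P e. \<Psi> K)" using P by (intro sum_mono) (simp add: good_def)
    also have "\<dots> = (\<Sum>(x, K)\<in>(\<Union>e. P e). \<Psi> K)"
      using fin disj by (subst sum.UNION_disjoint) auto
    finally have "good m l (\<Union>e. P e)"
      using td P unfolding good_def by (auto simp: fine_def)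
    then show ?thesis by blast
  qed
  have "\<exists>F. \<forall>m. ((\<forall>i. F m i < 2 ^ (k + m)) \<and> (\<nexists>p. good (k + m) (F m) p)) \<and> (\<exists>e. F (Suc m) = subcube (F m) e)"
  proof (rule dependent_nat_choice)
    show "\<exists>l. (\<forall>i. l i < 2 ^ (k + 0)) \<and> (\<nexists>p. good (k + 0) l p)" using bad j by auto
  next
    fix l m assume l: "(\<forall>i. l i < 2 ^ (k + m)) \<and> (\<nexists>p. good (k + m) l p)"
    then obtain e where "\<nexists>p. good (Suc (k + m)) (subcube l e) p" using step[of l "k + m"] by blast
    then show "\<exists>l'. ((\<forall>i. l' i < 2 ^ (k + Suc m)) \<and> (\<nexists>p. good (k + Suc m) l' p)) \<and> (\<exists>e. l' = subcube l e)"
      using subcube_less[of l "k + m" e] l by auto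
  qed
  then obtain F where F: "\<And>m. \<forall>i. F m i < 2 ^ (k + m)" "\<And>m. \<nexists>p. good (k + m) (F m) p"
    "\<And>m. \<exists>e. F (Suc m) = subcube (F m) e" by blast
  define S where "S m = dyadic_cube (k + m) (F m)" for m
  have "S (Suc m) \<subseteq> S m" for m
  proof -
    obtain e where "F (Suc m) = subcube (F m) e" using F(3) by blast
    then show ?thesis using subcube_subset[of "k + m" "F m" e] by (simp add: S_def)
  qed
  then have mono: "S n \<subseteq> S m" if "m \<le> n" for m n using that by (rule lift_Suc_antimono_le)
  have small: "\<exists>m. real CARD('n) / 2 ^ (k + m) < \<epsilon>" if pos: "0 < \<epsilon>" for \<epsilon>
  proof -
    have "0 < \<epsilon> / real CARD('n)" using pos by simp
    then obtain m where m: "(1/2 :: real) ^ m < \<epsilon> / real CARD('n)"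
      using real_arch_pow_inv[of "\<epsilon> / real CARD('n)" "1/2"] by (auto simp del: zero_less_divide_iff)
    have "real CARD('n) / 2 ^ (k + m) \<le> real CARD('n) / 2 ^ m" by (simp add: frac_le)
    also have "\<dots> < \<epsilon>" using m by (simp add: power_divide field_simps)
    finally show ?thesis by blast
  qed
  obtain x where x: "\<And>m. x \<in> S m"
  proof (rule decreasing_closed_nest[of S])
    show "\<exists>n. \<forall>x\<in>S n. \<forall>y\<in>S n. dist x y < \<epsilon>" if pos: "0 < \<epsilon>" for \<epsilon>
    proof -
      obtain m where "real CARD('n) / 2 ^ (k + m) < \<epsilon>" using small[OF pos] by blast
      then show ?thesis unfolding S_def by (intro exI[of _ m]) (meson dyadic_cube_small le_less_trans)
    qed
  qed (use mono in \<open>auto simp: S_def closed_dyadic_cube dyadic_cube_nonempty\<close>)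
  have "x \<in> \<gamma> x" "open (\<gamma> x)" using \<gamma> by (auto simp: gauge_def)
  then obtain \<epsilon> where \<epsilon>: "0 < \<epsilon>" "ball x \<epsilon> \<subseteq> \<gamma> x" using open_contains_ball by blast
  then obtain m where m: "real CARD('n) / 2 ^ (k + m) < \<epsilon>" using small by blast
  have "S m \<subseteq> \<gamma> x"
  proof
    fix y assume "y \<in> S m"
    then have "dist x y < \<epsilon>" using dyadic_cube_small[of x "k + m" "F m" y] x[of m] m by (auto simp: S_def)
    then show "y \<in> \<gamma> x" using \<epsilon> by auto
  qed
  moreover have "{(x, S m)} tagged_division_of S m"
    using tagged_division_of_self x[of m] unfolding S_def dyadic_cube_def by blast
  ultimately have "good (k + m) (F m) {(x, S m)}"
    using F(1)[of m] by (auto simp: good_def S_def fine_def dyadic_cubes_eq)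
  then show False using F(2) by blast
qed

section \<open>Averages of a weight bounded below by one\<close>

lemma integrable_lebesgue_on_subset:
  fixes f :: "'a::euclidean_space \<Rightarrow> real"
  assumes f: "integrable (lebesgue_on S) f" and "T \<subseteq> S" "S \<in> sets lebesgue" "T \<in> sets lebesgue"
  shows "integrable (lebesgue_on T) f"
proof -
  have "set_integrable lebesgue S f"
    using f assms(3) by (simp add: integrable_restrict_space set_integrable_def)
  then have "set_integrable lebesgue T f" using assms by (intro set_integrable_subset[of lebesgue S f T])
  then show ?thesis using assms(4) by (simp add: integrable_restrict_space set_integrable_def)
qed

lemma average_eq_integral:
  fixes f :: "'a::euclidean_space \<Rightarrow> real"
  assumes "integrable (lebesgue_on K) f" "K \<in> sets lebesgue"
  shows "average K f = integral K f / measure lebesgue K"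
  using lebesgue_integral_eq_integral[OF assms] by (simp add: average_def)

lemma dyadic_cube_lebesgue: "dyadic_cube k j \<in> sets lebesgue"
  by (simp add: dyadic_cube_def)

lemma dyadic_cube_subset_unit:
  fixes j :: "'n::finite \<Rightarrow> nat"
  shows "\<forall>i. j i < 2 ^ k \<Longrightarrow> dyadic_cube k j \<subseteq> unit_cube"
proof
  fix x :: "real ^ 'n" assume j: "\<forall>i. j i < 2 ^ k" and x: "x \<in> dyadic_cube k j"
  have "0 \<le> x $ i \<and> x $ i \<le> 1" for i
  proof -
    have "real (j i) \<le> x $ i * 2 ^ k" "x $ i * 2 ^ k \<le> real (j i) + 1" using x unfolding mem_dyadic_cube by auto
    moreover have "real (j i) + 1 \<le> 2 ^ k" using j[rule_format, of i] by (metis Suc_leI Suc_eq_plus1 of_nat_1 of_nat_add of_nat_le_iff of_nat_numeral of_nat_power)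
    moreover have "0 \<le> real (j i)" by simp
    ultimately have "0 \<le> x $ i * 2 ^ k" "x $ i * 2 ^ k \<le> 2 ^ k" by linarith+
    then show ?thesis
      using mult_le_cancel_right_pos[of "2 ^ k" 0 "x $ i"] mult_le_cancel_right_pos[of "2 ^ k" "x $ i" 1] by simp
  qed
  then show "x \<in> unit_cube" by (simp add: mem_box_cart)
qed

lemma average_ge:
  assumes f: "integrable (lebesgue_on K) f" and K: "K \<in> lmeasurable" "0 < measure lebesgue K"
    and c: "\<And>x. x \<in> K \<Longrightarrow> c \<le> f x"
  shows "c \<le> average K f"
proof -
  have S: "K \<in> sets lebesgue" using K by auto
  have "measure lebesgue K * c = integral\<^sup>L (lebesgue_on K) (\<lambda>_. c)"
    using S by (simp add: measure_restrict_space)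
  also have "\<dots> \<le> integral\<^sup>L (lebesgue_on K) f"
    using K c f by (intro integral_mono) (auto simp: fmeasurableD2 finite_measure.integrable_const finite_measure_lebesgue_on)
  finally show ?thesis using K by (simp add: average_def field_simps)
qed

text \<open>
With \<open>a\<close> the average of \<open>f\<close>, averaging \<open>2 \<le> f/a + a/f\<close> gives the claim.
\<close>

lemma average_product_ge_one:
  assumes f: "integrable (lebesgue_on K) f" "integrable (lebesgue_on K) (\<lambda>x. inverse (f x))"
    and K: "K \<in> lmeasurable" "0 < measure lebesgue K" and c: "0 < c" "\<And>x. x \<in> K \<Longrightarrow> c \<le> f x"
  shows "1 \<le> average K f * average K (\<lambda>x. inverse (f x))"
proof -
  define a where "a = average K f"
  have a: "0 < a" using average_ge[OF f(1) K c(2)] c(1) by (simp add: a_def)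
  have "2 \<le> average K (\<lambda>x. f x / a + a * inverse (f x))"
  proof (rule average_ge[OF _ K])
    show "integrable (lebesgue_on K) (\<lambda>x. f x / a + a * inverse (f x))"
      using f by simp
    fix x assume "x \<in> K"
    then have "0 < f x" using c by force
    then show "2 \<le> f x / a + a * inverse (f x)"
      using a by (intro sum_two_le_of_product_ge_one) (auto simp: field_simps)
  qed
  also have "\<dots> = average K f / a + a * average K (\<lambda>x. inverse (f x))"
    using f by (simp add: average_def add_divide_distrib)
  also have "average K f / a = 1" using a by (simp add: a_def)
  finally show ?thesis by (simp add: a_def)
qed

text \<open>
Weighted by the measure of the cube, the value of \<open>tangent_cap\<close> at the point of a cube is at most the
sum over its subcubes, hence over a fine dyadic division. For a cube with tag \<open>x\<close> the value is
bounded by the distance of the averages from \<open>(f x, 1 / f x)\<close>, and the sum of these errors is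
small by Henstock's lemma.
\<close>

lemma tangent_cap_average_eq_0:
  fixes f :: "real ^ 'n \<Rightarrow> real"
  assumes f: "f \<in> dyadic_A2 Q" and f1: "\<And>x. 1 \<le> f x" and Q: "1 \<le> Q" and r: "0 < r" "r < 1"
    and R: "1 + (Q - 1) * (2 ^ CARD('n) + 1)^2 / (4 * 2 ^ CARD('n)) \<le> 1 / (1 - r^2)"
  shows "tangent_cap r (average unit_cube f) (average unit_cube (\<lambda>x. inverse (f x))) = 0"
proof -
  define h where "h x = inverse (f x)" for x
  define N where "N = (2::real) ^ CARD('n)"
  have N: "0 < N" by (simp add: N_def)
  have int: "integrable (lebesgue_on unit_cube) f" "integrable (lebesgue_on unit_cube) h"
    and A2: "\<And>I. I \<in> dyadic_cubes \<Longrightarrow> average I f * average I h \<le> Q"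
    using f by (auto simp: dyadic_A2_def h_def[abs_def])
  have intk: "integrable (lebesgue_on (dyadic_cube k j)) f" "integrable (lebesgue_on (dyadic_cube k j)) h"
    if "\<forall>i. j i < 2 ^ k" for k j
    using int that by (auto intro!: integrable_lebesgue_on_subset[OF _ dyadic_cube_subset_unit] dyadic_cube_lebesgue)
  have HK: "f integrable_on unit_cube" "h integrable_on unit_cube"
    using int by (auto intro!: integrable_on_lebesgue_on)
  have meas: "dyadic_cube k j \<in> lmeasurable" "0 < measure lebesgue (dyadic_cube k j)" for k and j :: "'n \<Rightarrow> nat"
    unfolding measure_dyadic_cube by (auto simp: dyadic_cube_def)
  have avg: "average (dyadic_cube k j) g = integral (dyadic_cube k j) g * N ^ k"
    if "integrable (lebesgue_on (dyadic_cube k j)) g" for g k and j :: "'n \<Rightarrow> nat"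
    using average_eq_integral[OF that dyadic_cube_lebesgue] by (simp add: measure_dyadic_cube N_def)
  have avg_sub: "average (dyadic_cube k j) g = (\<Sum>e\<in>UNIV. average (dyadic_cube (Suc k) (subcube j e)) g) / N"
    if j: "\<forall>i. j i < 2 ^ k" and g: "\<And>k j. \<forall>i. j i < 2 ^ k \<Longrightarrow> integrable (lebesgue_on (dyadic_cube k j)) g"
    for g k and j :: "'n \<Rightarrow> nat"
  proof -
    have "average (dyadic_cube k j) g = integral (dyadic_cube k j) g * N ^ k" using avg g j by blast
    also have "integral (dyadic_cube k j) g = (\<Sum>e\<in>UNIV. integral (dyadic_cube (Suc k) (subcube j e)) g)"
      using g[OF j] by (intro integral_subcubes integrable_on_lebesgue_on dyadic_cube_lebesgue)
    also have "\<dots> * N ^ k = (\<Sum>e\<in>UNIV. average (dyadic_cube (Suc k) (subcube j e)) g) / N"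
      using N by (simp add: avg[OF g[OF subcube_less[OF j]]] sum_distrib_right[symmetric])
    finally show ?thesis .
  qed
  define \<Psi> where "\<Psi> K = measure lebesgue K * tangent_cap r (average K f) (average K h)" for K
  have sub: "\<Psi> (dyadic_cube k j) \<le> (\<Sum>e\<in>UNIV. \<Psi> (dyadic_cube (Suc k) (subcube j e)))"
    if j: "\<forall>i. j i < 2 ^ k" for k j
  proof -
    let ?c = "\<lambda>e. dyadic_cube (Suc k) (subcube j e)"
    have card: "card (UNIV :: ('n \<Rightarrow> bool) set) = 2 ^ CARD('n)" by (simp add: card_fun)
    have "(2::nat) ^ 1 \<le> 2 ^ CARD('n)" by (intro power_increasing) (auto simp: Suc_le_eq)
    then have card2: "2 \<le> card (UNIV :: ('n \<Rightarrow> bool) set)" by (simp add: card)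
    have "tangent_cap r (average (dyadic_cube k j) f) (average (dyadic_cube k j) h)
        \<le> (\<Sum>e\<in>UNIV. tangent_cap r (average (?c e) f) (average (?c e) h)) / card (UNIV :: ('n \<Rightarrow> bool) set)"
    proof (rule tangent_cap_le_mean[OF r _ card2 Q])
      show "1 + (Q - 1) * (real (card (UNIV :: ('n \<Rightarrow> bool) set)) + 1)^2 / (4 * real (card (UNIV :: ('n \<Rightarrow> bool) set))) \<le> 1 / (1 - r^2)"
        using R by (simp add: card)
      fix e
      note I = intk[OF subcube_less[OF j, of e]]
      have "1 \<le> average (?c e) f" by (rule average_ge[OF I(1) meas f1])
      moreover have p: "1 \<le> average (?c e) f * average (?c e) h"
        using average_product_ge_one[OF I(1) _ meas, of 1] I(2) f1 unfolding h_def by simp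
      ultimately have "0 < average (?c e) h" by (smt (verit) mult_nonneg_nonpos)
      moreover have "?c e \<in> dyadic_cubes" unfolding dyadic_cubes_eq using subcube_less[OF j, of e] by blast
      ultimately show "0 < average (?c e) f \<and> 0 < average (?c e) h \<and>
          1 \<le> average (?c e) f * average (?c e) h \<and> average (?c e) f * average (?c e) h \<le> Q"
        using p \<open>1 \<le> average (?c e) f\<close> A2 by auto
    next
      show "average (dyadic_cube k j) f * average (dyadic_cube k j) h \<le> Q"
        using j by (intro A2) (auto simp: dyadic_cubes_eq)
    qed (use j intk in \<open>auto simp: avg_sub card N_def\<close>)
    then have "measure lebesgue (dyadic_cube k j) * tangent_cap r (average (dyadic_cube k j) f) (average (dyadic_cube k j) h)
      \<le> measure lebesgue (dyadic_cube k j) * ((\<Sum>e\<in>UNIV. tangent_cap r (average (?c e) f) (average (?c e) h)) / N)"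
      unfolding card by (intro mult_left_mono) (simp_all add: N_def)
    also have "\<dots> = (\<Sum>e\<in>UNIV. \<Psi> (?c e))"
      by (simp add: \<Psi>_def measure_dyadic_cube N_def sum_divide_distrib mult.commute)
    finally show ?thesis by (simp add: \<Psi>_def)
  qed
  have root: "unit_cube = dyadic_cube 0 (\<lambda>_::'n. 0)" by (rule unit_cube_eq)
  have small: "\<Psi> unit_cube \<le> \<epsilon>" if "0 < \<epsilon>" for \<epsilon>
  proof -
    have \<epsilon>: "0 < \<epsilon> / 4" using that by simp
    obtain \<gamma>1 where \<gamma>1: "gauge \<gamma>1" "\<And>p. p tagged_partial_division_of unit_cube \<Longrightarrow> \<gamma>1 fine p \<Longrightarrow>
        (\<Sum>(x, K)\<in>p. norm (measure lborel K *\<^sub>R f x - integral K f)) < \<epsilon> / 4"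
      using Henstock_lemma[OF HK(1) \<epsilon>] by blast
    obtain \<gamma>2 where \<gamma>2: "gauge \<gamma>2" "\<And>p. p tagged_partial_division_of unit_cube \<Longrightarrow> \<gamma>2 fine p \<Longrightarrow>
        (\<Sum>(x, K)\<in>p. norm (measure lborel K *\<^sub>R h x - integral K h)) < \<epsilon> / 4"
      using Henstock_lemma[OF HK(2) \<epsilon>] by blast
    obtain p where p: "p tagged_division_of unit_cube" "(\<lambda>x. \<gamma>1 x \<inter> \<gamma>2 x) fine p" "snd ` p \<subseteq> dyadic_cubes"
      and le: "\<Psi> unit_cube \<le> (\<Sum>(x, K)\<in>p. \<Psi> K)"
      using dyadic_fine_division[OF gauge_Int[OF \<gamma>1(1) \<gamma>2(1)], of "\<lambda>_. 0" 0 \<Psi>] sub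
      unfolding root by auto
    have pp: "p tagged_partial_division_of unit_cube" using p(1) by (simp add: tagged_division_of_def)
    have "(\<Sum>(x, K)\<in>p. \<Psi> K) \<le> (\<Sum>(x, K)\<in>p. 2 * (norm (measure lborel K *\<^sub>R f x - integral K f)
        + norm (measure lborel K *\<^sub>R h x - integral K h)))"
    proof (rule sum_mono, clarify)
      fix x K assume "(x, K) \<in> p"
      then have "K \<in> dyadic_cubes" using p(3) by force
      then obtain k and j :: "'n \<Rightarrow> nat" where K: "K = dyadic_cube k j" and j: "\<forall>i. j i < 2 ^ k"
        unfolding dyadic_cubes_eq by blast
      note I = intk[OF j, folded K]
      have M: "K \<in> lmeasurable" "0 < measure lebesgue K" using meas[of k j] by (simp_all add: K)
      have S: "K \<in> sets lebesgue" using M by auto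
      have mK: "measure lborel K = measure lebesgue K"
        unfolding K dyadic_cube_def by simp
      have "average K h \<le> 1"
      proof -
        have "-1 \<le> average K (\<lambda>x. - h x)"
        proof (rule average_ge[OF _ M])
          show "integrable (lebesgue_on K) (\<lambda>x. - h x)" using I(2) by simp
          show "- 1 \<le> - h x" for x using f1[of x] by (simp add: h_def inverse_le_1_iff)
        qed
        then show ?thesis by (simp add: average_def)
      qed
      then have "\<Psi> K \<le> measure lebesgue K * (2 * (\<bar>average K f - f x\<bar> + \<bar>average K h - inverse (f x)\<bar>))"
        unfolding \<Psi>_def using M f1 by (intro mult_left_mono tangent_cap_le_distance[OF r]) auto
      also have "\<dots> = 2 * (\<bar>measure lebesgue K * (average K f - f x)\<bar> + \<bar>measure lebesgue K * (average K h - h x)\<bar>)"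
        using M unfolding abs_mult h_def by (simp add: distrib_left mult.left_commute)
      also have "measure lebesgue K * (average K f - f x) = integral K f - measure lborel K * f x"
        using M by (simp add: average_eq_integral[OF I(1) S] mK right_diff_distrib)
      also have "measure lebesgue K * (average K h - h x) = integral K h - measure lborel K * h x"
        using M by (simp add: average_eq_integral[OF I(2) S] mK right_diff_distrib)
      finally show "\<Psi> K \<le> 2 * (norm (measure lborel K *\<^sub>R f x - integral K f)
        + norm (measure lborel K *\<^sub>R h x - integral K h))"
        by (simp add: abs_minus_commute)
    qed
    also have "\<dots> = 2 * ((\<Sum>(x, K)\<in>p. norm (measure lborel K *\<^sub>R f x - integral K f))
       + (\<Sum>(x, K)\<in>p. norm (measure lborel K *\<^sub>R h x - integral K h)))"
      by (simp add: sum_distrib_left sum.distrib split_def algebra_simps)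
    also have "\<dots> \<le> 2 * (\<epsilon> / 4 + \<epsilon> / 4)"
    proof -
      have "\<gamma>1 fine p" "\<gamma>2 fine p" using p(2) by (auto simp: fine_def)
      from \<gamma>1(2)[OF pp this(1)] \<gamma>2(2)[OF pp this(2)] show ?thesis
        by (intro mult_left_mono add_mono less_imp_le) simp_all
    qed
    finally show ?thesis using le by simp
  qed
  have "\<Psi> unit_cube \<le> 0" by (rule field_le_epsilon) (use small in simp)
  moreover have "measure lebesgue (unit_cube :: (real^'n) set) = 1" unfolding root measure_dyadic_cube by simp
  ultimately show ?thesis using tangent_cap_nonneg[of r "average unit_cube f" "average unit_cube h"]
    by (simp add: \<Psi>_def h_def[abs_def])
qed

section \<open>Truncation of dyadic weights\<close>

lemma unit_cube_dyadic: "unit_cube \<in> dyadic_cubes"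
  unfolding dyadic_cubes_eq unit_cube_eq by (intro CollectI exI[of _ 0] exI[of _ "\<lambda>_. 0"]) auto

lemma dyadic_A2_inverse:
  assumes "\<phi> \<in> dyadic_A2 Q"
  shows "(\<lambda>x. inverse (\<phi> x)) \<in> dyadic_A2 Q"
  using assms by (auto simp: dyadic_A2_def mult.commute)

lemma dyadic_A2_scale:
  fixes \<phi> :: "real ^ 'n \<Rightarrow> real"
  assumes "\<phi> \<in> dyadic_A2 Q" "0 < c"
  shows "(\<lambda>x. \<phi> x / c) \<in> dyadic_A2 Q"
proof -
  have "average I (\<lambda>x. \<phi> x / c) * average I (\<lambda>x. inverse (\<phi> x / c))
      = average I \<phi> * average I (\<lambda>x. inverse (\<phi> x))" for I :: "(real ^ 'n) set"
  proof -
    have "(\<lambda>x. inverse (\<phi> x / c)) = (\<lambda>x. c * inverse (\<phi> x))" by (simp add: fun_eq_iff divide_inverse)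
    then show ?thesis using assms(2) by (simp add: average_def)
  qed
  moreover have "(\<lambda>x. inverse (\<phi> x / c)) = (\<lambda>x. c * inverse (\<phi> x))" by (simp add: fun_eq_iff divide_inverse)
  ultimately show ?thesis using assms unfolding dyadic_A2_def by auto
qed

lemma dyadic_cubesD:
  assumes "I \<in> dyadic_cubes"
  shows "I \<subseteq> unit_cube" "I \<in> sets lebesgue" "I \<in> lmeasurable" "0 < measure lebesgue I"
proof -
  obtain k j where I: "I = dyadic_cube k j" "\<forall>i. j i < 2 ^ k" using assms unfolding dyadic_cubes_eq by blast
  show "I \<subseteq> unit_cube" using I dyadic_cube_subset_unit by blast
  show "I \<in> sets lebesgue" using I dyadic_cube_lebesgue by blast
  show "I \<in> lmeasurable" unfolding I by (simp add: dyadic_cube_def)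
  show "0 < measure lebesgue I" unfolding I by (simp add: measure_dyadic_cube)
qed

text \<open>
Let \<open>\<psi> = max c \<phi>\<close>, \<open>k = 1/\<phi> - 1/\<psi>\<close> and \<open>h = \<psi> - \<phi>\<close>, so that \<open>h = c k \<phi>\<close>. Since \<open>k\<close> is a decreasing
function of \<open>\<phi>\<close>, Chebyshev's inequality bounds the average of \<open>h\<close> by \<open>c\<close> times the product of the
averages of \<open>k\<close> and \<open>\<phi>\<close>. As \<open>1/\<psi> \<le> 1/c\<close>, raising \<open>\<phi>\<close> to \<open>\<psi>\<close> adds to the product of the averages no
more than lowering \<open>1/\<phi>\<close> to \<open>1/\<psi>\<close> removes.
\<close>

lemma truncated_average_product_le:
  fixes \<phi> :: "'a::euclidean_space \<Rightarrow> real"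
  assumes int: "integrable (lebesgue_on I) \<phi>" "integrable (lebesgue_on I) (\<lambda>x. inverse (\<phi> x))"
    and pos: "AE x in lebesgue_on I. 0 < \<phi> x" and I: "I \<in> lmeasurable" "0 < measure lebesgue I" and c: "0 < c"
  shows "integrable (lebesgue_on I) (\<lambda>x. max c (\<phi> x))"
    and "integrable (lebesgue_on I) (\<lambda>x. inverse (max c (\<phi> x)))"
    and "average I (\<lambda>x. max c (\<phi> x)) * average I (\<lambda>x. inverse (max c (\<phi> x)))
      \<le> average I \<phi> * average I (\<lambda>x. inverse (\<phi> x))"
proof -
  let ?M = "lebesgue_on I"
  define \<psi> where "\<psi> x = max c (\<phi> x)" for x
  have S: "I \<in> sets lebesgue" using I by auto
  interpret finite_measure ?M by (rule finite_measure_lebesgue_on[OF I(1)])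
  have space: "measure ?M (space ?M) = measure lebesgue I" using S by (simp add: measure_restrict_space)
  show int\<psi>: "integrable ?M (\<lambda>x. max c (\<phi> x))" using int(1) by (intro integrable_max) auto
  have meas: "\<phi> \<in> borel_measurable ?M" using int(1) by (rule borel_measurable_integrable)
  show inti: "integrable ?M (\<lambda>x. inverse (max c (\<phi> x)))"
  proof (rule integrable_const_bound[of _ "inverse c"])
    show "AE x in ?M. norm (inverse (max c (\<phi> x))) \<le> inverse c"
    proof (rule AE_I2)
      fix x
      have "inverse (max c (\<phi> x)) \<le> inverse c" using c by (intro le_imp_inverse_le) auto
      then show "norm (inverse (max c (\<phi> x))) \<le> inverse c" using c by simp
    qed
  qed (use meas in measurable)
  define a where "a = average I \<phi>"
  define k where "k x = inverse (\<phi> x) - inverse (\<psi> x)" for x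
  define h where "h x = \<psi> x - \<phi> x" for x
  have intk: "integrable ?M k" using int(2) inti by (simp add: k_def[abs_def] \<psi>_def)
  have inth: "integrable ?M h" using int(1) int\<psi> by (simp add: h_def[abs_def] \<psi>_def)
  have "0 < integral\<^sup>L ?M \<phi>"
  proof -
    have nn: "AE x in ?M. 0 \<le> \<phi> x" using pos by eventually_elim simp
    have "integral\<^sup>L ?M \<phi> \<noteq> 0"
    proof
      assume "integral\<^sup>L ?M \<phi> = 0"
      then have "AE x in ?M. \<phi> x = 0" using integral_nonneg_eq_0_iff_AE[OF int(1) nn] by simp
      with pos have "AE x in ?M. False" by eventually_elim simp
      then have "ae_filter ?M = bot" by (simp only: eventually_False)
      then have "emeasure ?M (space ?M) = 0" by (simp only: ae_filter_eq_bot_iff)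
      then show False using I(2) unfolding space[symmetric] by (simp add: measure_def)
    qed
    then show ?thesis using integral_nonneg_AE[OF nn] by simp
  qed
  then have a: "0 < a" using I by (simp add: a_def average_def)
  have A: "average I \<psi> = a + average I h"
    using int(1) int\<psi> by (simp add: h_def[abs_def] \<psi>_def[abs_def] a_def average_def diff_divide_distrib)
  have B: "average I (\<lambda>x. inverse (\<psi> x)) = average I (\<lambda>x. inverse (\<phi> x)) - average I k"
    using int(2) inti by (simp add: k_def[abs_def] \<psi>_def[abs_def] average_def diff_divide_distrib)
  have k: "0 \<le> average I k"
  proof -
    have "AE x in ?M. 0 \<le> k x" using pos
    proof eventually_elim
      case (elim x)
      then have "inverse (\<psi> x) \<le> inverse (\<phi> x)" by (intro le_imp_inverse_le) (auto simp: \<psi>_def)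
      then show ?case by (simp add: k_def)
    qed
    then show ?thesis unfolding average_def by (intro divide_nonneg_nonneg integral_nonneg_AE) auto
  qed
  define k0 where "k0 = inverse a - inverse (max c a)"
  have "integral\<^sup>L ?M h \<le> integral\<^sup>L ?M (\<lambda>x. c * (a * k x + k0 * (\<phi> x - a)))"
  proof (rule integral_mono_AE[OF inth])
    show "integrable ?M (\<lambda>x. c * (a * k x + k0 * (\<phi> x - a)))" using intk int(1) by simp
    show "AE x in ?M. h x \<le> c * (a * k x + k0 * (\<phi> x - a))" using pos
    proof eventually_elim
      case (elim x)
      have anti: "inverse y - inverse (max c y) \<le> inverse z - inverse (max c z)" if "0 < z" "z \<le> y" for y z
      proof -
        have "inverse y \<le> inverse z" "z \<le> c \<Longrightarrow> inverse c \<le> inverse z"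
          using that by (auto intro!: le_imp_inverse_le)
        then show ?thesis using that by (auto simp: max_def)
      qed
      have "(k x - k0) * (\<phi> x - a) \<le> 0"
      proof (cases "a \<le> \<phi> x")
        case True
        then have "k x \<le> k0" using anti[of a "\<phi> x"] a by (simp add: k_def k0_def \<psi>_def)
        then show ?thesis using True by (intro mult_nonpos_nonneg) auto
      next
        case False
        then have "k0 \<le> k x" using anti[of "\<phi> x" a] elim by (simp add: k_def k0_def \<psi>_def)
        then show ?thesis using False by (intro mult_nonneg_nonpos) auto
      qed
      then have "k x * \<phi> x \<le> a * k x + k0 * (\<phi> x - a)" by (simp add: algebra_simps)
      then have "c * (k x * \<phi> x) \<le> c * (a * k x + k0 * (\<phi> x - a))" using c by (intro mult_left_mono) auto
      moreover have "h x = c * (k x * \<phi> x)"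
      proof (cases "\<phi> x \<le> c")
        case True
        then show ?thesis using elim c by (simp add: h_def k_def \<psi>_def max_def left_diff_distrib right_diff_distrib)
      next
        case False
        then show ?thesis by (simp add: h_def k_def \<psi>_def max_def)
      qed
      ultimately show ?case by simp
    qed
  qed
  also have "\<dots> = c * (a * integral\<^sup>L ?M k + k0 * (integral\<^sup>L ?M \<phi> - a * measure lebesgue I))"
    using intk int(1) space by (simp add: mult.commute)
  also have "integral\<^sup>L ?M \<phi> = a * measure lebesgue I" using I by (simp add: a_def average_def)
  finally have "average I h \<le> c * (a * average I k)"
    using I by (simp add: average_def divide_right_mono less_imp_le)
  moreover have Bc: "average I (\<lambda>x. inverse (\<psi> x)) \<le> inverse c"
  proof -
    have "- inverse c \<le> average I (\<lambda>x. - inverse (\<psi> x))"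
    proof (rule average_ge[OF _ I])
      show "integrable ?M (\<lambda>x. - inverse (\<psi> x))" using inti by (simp add: \<psi>_def)
      show "- inverse c \<le> - inverse (\<psi> x)" for x
        unfolding neg_le_iff_le using c by (intro le_imp_inverse_le) (auto simp: \<psi>_def)
    qed
    then show ?thesis by (simp add: average_def)
  qed
  moreover have B0: "0 \<le> average I (\<lambda>x. inverse (\<psi> x))"
    using inti c by (intro average_ge[OF _ I]) (auto simp: \<psi>_def max_def)
  ultimately have "average I h * average I (\<lambda>x. inverse (\<psi> x)) \<le> c * (a * average I k) * inverse c"
    using a c k by (intro mult_mono) auto
  also have "c * (a * average I k) * inverse c = a * average I k" using c by (simp add: field_simps)
  finally have "average I \<psi> * average I (\<lambda>x. inverse (\<psi> x)) \<le> a * average I (\<lambda>x. inverse (\<phi> x))"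
    unfolding A B by (simp add: algebra_simps)
  then show "average I (\<lambda>x. max c (\<phi> x)) * average I (\<lambda>x. inverse (max c (\<phi> x)))
      \<le> average I \<phi> * average I (\<lambda>x. inverse (\<phi> x))" by (simp add: a_def \<psi>_def[abs_def])
qed

lemma dyadic_A2_truncate:
  fixes \<phi> :: "real ^ 'n \<Rightarrow> real"
  assumes \<phi>: "\<phi> \<in> dyadic_A2 Q" and c: "0 < c"
  shows "(\<lambda>x. max c (\<phi> x)) \<in> dyadic_A2 Q"
proof -
  have int: "integrable (lebesgue_on unit_cube) \<phi>" "integrable (lebesgue_on unit_cube) (\<lambda>x. inverse (\<phi> x))"
    and pos: "AE x in lebesgue_on unit_cube. 0 < \<phi> x"
    and A2: "\<And>I. I \<in> dyadic_cubes \<Longrightarrow> average I \<phi> * average I (\<lambda>x. inverse (\<phi> x)) \<le> Q"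
    using \<phi> by (auto simp: dyadic_A2_def)
  note U = unit_cube_dyadic
  show ?thesis unfolding dyadic_A2_def
  proof (intro CollectI conjI ballI)
    show "integrable (lebesgue_on unit_cube) (\<lambda>x. max c (\<phi> x))"
      "integrable (lebesgue_on unit_cube) (\<lambda>x. inverse (max c (\<phi> x)))"
      using truncated_average_product_le(1,2)[OF int pos dyadic_cubesD(3,4)[OF U] c] by auto
    show "AE x in lebesgue_on unit_cube. 0 < max c (\<phi> x)" using c by simp
    fix I :: "(real^'n) set" assume I: "I \<in> dyadic_cubes"
    note D = dyadic_cubesD[OF I]
    have i: "integrable (lebesgue_on I) \<phi>" "integrable (lebesgue_on I) (\<lambda>x. inverse (\<phi> x))"
      using int D by (auto intro: integrable_lebesgue_on_subset)
    have "AE x in lebesgue_on I. 0 < \<phi> x"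
      using pos D(1,2) by (auto simp: AE_restrict_space_iff elim!: AE_mp)
    then show "average I (\<lambda>x. max c (\<phi> x)) * average I (\<lambda>x. inverse (max c (\<phi> x))) \<le> Q"
      using truncated_average_product_le(3)[OF i _ D(3,4) c] A2[OF I] by linarith
  qed
qed

section \<open>Bounds for weights with a one-sided bound\<close>

text \<open>
The new point lies on the ray from \<open>(1, 1)\<close> through \<open>(x1, x2)\<close>, beyond \<open>(x1, x2)\<close>. If its product
were too large, this ray would run above the tangent, so \<open>(x1, x2)\<close> would be in the right piece. From
there on the product decreases along the ray.
\<close>

lemma product_on_ray_le:
  fixes r x1 x2 t :: real
  assumes r: "0 < r" "r < 1" and t: "0 < t" "t \<le> 1" and x: "1 \<le> x1" "0 < x2"
    and R: "x1 * x2 \<le> 1 / (1 - r^2)" and cap: "tangent_cap r x1 x2 = 0"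
  shows "(1 + (x1 - 1) / t) * (1 + (x2 - 1) / t) \<le> 1 / (1 - r^2)"
proof (rule ccontr)
  define u v where "u = 1 + (x1 - 1) / t" and "v = 1 + (x2 - 1) / t"
  assume "\<not> ?thesis"
  then have uv: "1 / (1 - r^2) < u * v" by (simp add: u_def v_def)
  have r2: "0 < 1 - r^2" using r by (simp add: power_less_one_iff)
  define p q where "p = (1 - r) * x1" and "q = (1 + r) * x2"
  have pq: "0 < p" "0 < q" using r x by (auto simp: p_def q_def)
  have pq1: "p * q \<le> 1"
  proof -
    have "p * q = (1 - r^2) * (x1 * x2)" by (simp add: p_def q_def algebra_simps power2_eq_square)
    also have "\<dots> \<le> 1" using R r2 by (simp add: pos_le_divide_eq mult.commute)
    finally show ?thesis .
  qed
  have u: "0 < u" using x t by (auto simp: u_def intro: add_pos_nonneg)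
  have "0 < u * v" using uv r2 by (smt (verit) divide_pos_pos)
  then have v: "0 < v" using u by (simp add: zero_less_mult_iff)
  have PQ: "1 < ((1 - r) * u) * ((1 + r) * v)"
  proof -
    have "((1 - r) * u) * ((1 + r) * v) = (1 - r^2) * (u * v)" by (simp add: algebra_simps power2_eq_square)
    also have "\<dots> > 1" using uv r2 by (simp add: pos_divide_less_eq mult.commute)
    finally show ?thesis .
  qed
  have L2: "2 < (1 - r) * u + (1 + r) * v"
  proof -
    have "2 \<le> (1 - r) * u + (1 + r) * v"
      using PQ r u v by (intro sum_two_le_of_product_ge_one) auto
    moreover have "(1 - r) * u + (1 + r) * v \<noteq> 2"
    proof
      assume "(1 - r) * u + (1 + r) * v = 2"
      then have "(1 + r) * v = 2 - (1 - r) * u" by simp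
      then have "((1 - r) * u) * ((1 + r) * v) = 1 - ((1 - r) * u - 1)^2"
        by (simp only:) (simp add: power2_eq_square algebra_simps)
      then show False using PQ by (smt (verit) zero_le_power2)
    qed
    ultimately show ?thesis by simp
  qed
  have pu: "(1 - r) * u = (1 - r) + (p - (1 - r)) / t" and qv: "(1 + r) * v = (1 + r) + (q - (1 + r)) / t"
    by (simp_all add: u_def v_def p_def q_def algebra_simps add_divide_distrib diff_divide_distrib)
  have "2 < 2 + (p + q - 2) / t"
    using L2 unfolding pu qv by (simp add: add_divide_distrib diff_divide_distrib algebra_simps)
  then have L: "2 < p + q" using t by (simp add: zero_less_divide_iff)
  then have p1: "1 \<le> p" using cap by (auto simp: tangent_cap_def p_def q_def max_def split: if_splits)
  have "p * (1 + r) + q * (1 - r) - 2 * (p * q) \<ge> 0"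
  proof -
    have "q \<le> p" using pq1 p1 mult_right_mono[OF p1, of q] pq by linarith
    then have "0 \<le> r * (p - q)" using r by simp
    then show ?thesis using L pq1 by (simp add: algebra_simps)
  qed
  then have k1: "(p - (1 - r)) * q - p * ((1 + r) - q) \<le> 0" by (simp add: algebra_simps)
  \<comment> \<open>the new point is reached from \<open>(p, q)\<close> by going on by \<open>l\<close> times the vector from \<open>(1 - r, 1 + r)\<close> to \<open>(p, q)\<close>\<close>
  define l where "l = 1 / t - 1"
  have l: "0 \<le> l" using t by (simp add: l_def)
  have pu': "(1 - r) * u = p + l * (p - (1 - r))" and qv': "(1 + r) * v = q - l * ((1 + r) - q)"
    unfolding pu qv l_def by (simp_all add: algebra_simps add_divide_distrib diff_divide_distrib)
  have m: "0 \<le> p - (1 - r)" using x r by (simp add: p_def)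
  show False
  proof (cases "q \<le> 1 + r")
    case True
    have "((1 - r) * u) * ((1 + r) * v) = p * q + l * ((p - (1 - r)) * q - p * ((1 + r) - q))
        - l * l * ((p - (1 - r)) * ((1 + r) - q))"
      unfolding pu' qv' by (simp add: algebra_simps)
    moreover have "l * ((p - (1 - r)) * q - p * ((1 + r) - q)) \<le> 0" using l k1 by (rule mult_nonneg_nonpos)
    moreover have "0 \<le> l * l * ((p - (1 - r)) * ((1 + r) - q))" using l m True by simp
    ultimately show False using PQ pq1 by linarith
  next
    case False
    then have "1 < q" using r by linarith
    then have "1 < p * q" using mult_right_mono[OF p1, of q] by linarith
    then show False using pq1 by simp
  qed
qed

text \<open>
If \<open>\<psi>\<close> had the value \<open>c\<close> on a set of measure \<open>1 - t\<close>, the two factors would be the integrals of \<open>\<psi>\<close>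
and \<open>1/\<psi>\<close> over the rest, and the claim would be the bound for the averages over the rest. For \<open>c = 1\<close>
the point of these averages lies on the ray from \<open>(1, 1)\<close> through the point of the cube, where
\<open>product_on_ray_le\<close> applies.
\<close>

lemma dyadic_A2_bounded_below:
  fixes \<psi> :: "real ^ 'n \<Rightarrow> real"
  assumes \<psi>: "\<psi> \<in> dyadic_A2 Q" and Q: "1 \<le> Q" and c: "0 < c" "\<And>x. c \<le> \<psi> x" and t: "0 < t" "t \<le> 1"
  defines "A \<equiv> average unit_cube \<psi>" and "B \<equiv> average unit_cube (\<lambda>x. inverse (\<psi> x))"
  shows "(A - (1 - t) * c) * (B - (1 - t) / c) \<le> extension_constant CARD('n) Q * t^2"
proof (rule ccontr)
  define f where "f x = \<psi> x / c" for x
  note U = unit_cube_dyadic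
  note D = dyadic_cubesD[OF U]
  have f: "f \<in> dyadic_A2 Q" using dyadic_A2_scale[OF \<psi> c(1)] by (simp add: f_def[abs_def])
  have f1: "1 \<le> f x" for x using c by (simp add: f_def)
  have "(\<lambda>x. inverse (f x)) = (\<lambda>x. inverse (\<psi> x) * c)" by (simp add: f_def fun_eq_iff divide_inverse)
  then have avg: "average unit_cube f = A / c" "average unit_cube (\<lambda>x. inverse (f x)) = B * c"
    by (simp_all add: f_def[abs_def] average_def A_def B_def)
  have int: "integrable (lebesgue_on unit_cube) f" "integrable (lebesgue_on unit_cube) (\<lambda>x. inverse (f x))"
    and ABQ: "average unit_cube f * average unit_cube (\<lambda>x. inverse (f x)) \<le> Q"
    using f U by (auto simp: dyadic_A2_def)
  have AB1: "1 \<le> average unit_cube f * average unit_cube (\<lambda>x. inverse (f x))"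
    using average_product_ge_one[OF int D(3,4), of 1] f1 by simp
  have A1: "1 \<le> A / c" using average_ge[OF int(1) D(3,4) f1] by (simp add: avg)
  then have Bpos: "0 < B * c" using AB1 unfolding avg by (smt (verit) mult_nonneg_nonpos)
  define X where "X = (1 + (A / c - 1) / t) * (1 + (B * c - 1) / t)"
  have "(A - (1 - t) * c) = c * t * (1 + (A / c - 1) / t)" using c t by (simp add: field_simps)
  moreover have "(B - (1 - t) / c) = t / c * (1 + (B * c - 1) / t)" using c t by (simp add: field_simps)
  ultimately have X: "(A - (1 - t) * c) * (B - (1 - t) / c) = X * t^2"
    using c by (simp add: X_def power2_eq_square)
  assume "\<not> ?thesis"
  then have "extension_constant CARD('n) Q < X" using t unfolding X by (simp add: mult_less_cancel_right not_le)
  then obtain R where R: "extension_constant CARD('n) Q < R" "R < X" using dense by blast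
  have R1: "1 < R" using R Q extension_constant_ge[OF Q, of "CARD('n)"] by linarith
  define r where "r = sqrt (1 - 1 / R)"
  have r: "0 < r" "r < 1" "1 / (1 - r^2) = R" using R1 by (auto simp: r_def)
  have "tangent_cap r (A / c) (B * c) = 0"
    using tangent_cap_average_eq_0[OF f f1 Q r(1,2)] R(1) unfolding r(3) avg by (simp add: extension_constant_def)
  then have "X \<le> R"
    using product_on_ray_le[OF r(1,2) t A1 Bpos] ABQ R(1) extension_constant_ge[OF Q, of "CARD('n)"]
    unfolding r(3) avg X_def by linarith
  with R show False by simp
qed

lemma dyadic_A2_bounded_above:
  fixes \<psi> :: "real ^ 'n \<Rightarrow> real"
  assumes \<psi>: "\<psi> \<in> dyadic_A2 Q" and Q: "1 \<le> Q" and d: "\<And>x. 0 < \<psi> x" "\<And>x. \<psi> x \<le> d" and t: "0 < t" "t \<le> 1"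
  defines "A \<equiv> average unit_cube \<psi>" and "B \<equiv> average unit_cube (\<lambda>x. inverse (\<psi> x))"
  shows "(A - (1 - t) * d) * (B - (1 - t) / d) \<le> extension_constant CARD('n) Q * t^2"
proof -
  have d0: "0 < d" using d[of 0] by linarith
  have "inverse d \<le> inverse (\<psi> x)" for x using d by (intro le_imp_inverse_le)
  then have "(B - (1 - t) * inverse d) * (A - (1 - t) / inverse d) \<le> extension_constant CARD('n) Q * t^2"
    using dyadic_A2_bounded_below[OF dyadic_A2_inverse[OF \<psi>] Q, of "inverse d" t] d0 t
    unfolding A_def B_def by simp
  then show ?thesis by (simp add: mult.commute divide_inverse)
qed

section \<open>Integrals and values of the rearrangement\<close>

lemma is_monotonic_rearrangement_monotonic_rearrangement:
  fixes \<phi> :: "real ^ 'n \<Rightarrow> real"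
  assumes "\<phi> \<in> borel_measurable (lebesgue_on unit_cube)"
  shows "is_monotonic_rearrangement \<phi> (monotonic_rearrangement \<phi>)"
  unfolding monotonic_rearrangement_def using ex_monotonic_rearrangement[OF assms] by (rule someI_ex)

lemma rearrangement_integral:
  fixes \<phi> :: "real ^ 'n \<Rightarrow> real" and u :: "real \<Rightarrow> real"
  assumes g: "is_monotonic_rearrangement \<phi> g" and \<phi>: "\<phi> \<in> borel_measurable (lebesgue_on unit_cube)"
    and u: "u \<in> borel_measurable borel"
  shows "integrable (lebesgue_on {0..1}) (\<lambda>t. u (g t)) \<longleftrightarrow> integrable (lebesgue_on unit_cube) (\<lambda>x. u (\<phi> x))"
    and "average {0..1} (\<lambda>t. u (g t)) = average unit_cube (\<lambda>x. u (\<phi> x))"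
proof -
  have gm: "g \<in> borel_measurable (lebesgue_on {0..1})"
    and d: "distr (lebesgue_on {0..1}) borel g = distr (lebesgue_on unit_cube) borel \<phi>"
    using g by (auto simp: is_monotonic_rearrangement_def)
  show "integrable (lebesgue_on {0..1}) (\<lambda>t. u (g t)) \<longleftrightarrow> integrable (lebesgue_on unit_cube) (\<lambda>x. u (\<phi> x))"
    using integrable_distr_eq[OF gm u] integrable_distr_eq[OF \<phi> u] d by simp
  have "measure lebesgue (unit_cube :: (real ^ 'n) set) = 1"
    unfolding unit_cube_eq measure_dyadic_cube by simp
  then show "average {0..1} (\<lambda>t. u (g t)) = average unit_cube (\<lambda>x. u (\<phi> x))"
    using integral_distr[OF gm u] integral_distr[OF \<phi> u] d by (simp add: average_def)
qed

lemma rearrangement_AE: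
  fixes \<phi> :: "real ^ 'n \<Rightarrow> real"
  assumes g: "is_monotonic_rearrangement \<phi> g" and \<phi>: "\<phi> \<in> borel_measurable (lebesgue_on unit_cube)"
    and P: "{y. P y} \<in> sets borel" and AE: "AE x in lebesgue_on unit_cube. P (\<phi> x)"
  shows "AE t in lebesgue_on {0..1}. P (g t)"
proof -
  have gm: "g \<in> borel_measurable (lebesgue_on {0..1})"
    and d: "distr (lebesgue_on {0..1}) borel g = distr (lebesgue_on unit_cube) borel \<phi>"
    using g by (auto simp: is_monotonic_rearrangement_def)
  have "AE y in distr (lebesgue_on unit_cube) borel \<phi>. P y" using AE_distr_iff[OF \<phi>, of P] P AE by simp
  then have "AE y in distr (lebesgue_on {0..1}) borel g. P y" by (simp only: d)
  then show ?thesis using AE_distr_iff[OF gm, of P] P by simp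
qed

text \<open>
A monotone function that has a property for almost all arguments has it everywhere, if larger values
inherit the property: one failure at \<open>t\<close> would be a failure on all of \<open>[t, 1)\<close>.
\<close>

lemma rearrangement_everywhere:
  fixes \<phi> :: "real ^ 'n \<Rightarrow> real"
  assumes g: "is_monotonic_rearrangement \<phi> g" and \<phi>: "\<phi> \<in> borel_measurable (lebesgue_on unit_cube)"
    and P: "{y. P y} \<in> sets borel" and up: "\<And>y z. P y \<Longrightarrow> y \<le> z \<Longrightarrow> P z"
    and AE: "AE x in lebesgue_on unit_cube. P (\<phi> x)" and t: "0 < t" "t < 1"
  shows "P (g t)"
proof (rule ccontr)
  assume n: "\<not> P (g t)"
  have "g s \<le> g t" if "s \<in> {t..<1}" for s
    using g that t by (auto simp: is_monotonic_rearrangement_def monotone_on_def)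
  with n have np: "\<not> P (g s)" if "s \<in> {t..<1}" for s using that up by blast
  have "AE s in lebesgue_on {0..1}. P (g s)" by (rule rearrangement_AE[OF g \<phi> P AE])
  then have "AE s in lebesgue. s \<in> {0..1} \<longrightarrow> P (g s)" by (simp add: AE_restrict_space_iff)
  then have "AE s in lebesgue. s \<notin> {t..<1}" by eventually_elim (use np t in auto)
  then have "{t..<1} \<in> null_sets lebesgue" by (subst AE_iff_null_sets) auto
  then show False using t by (simp add: null_sets_def)
qed

section \<open>Intervals of the rearrangement\<close>

text \<open>
Here \<open>(u, v)\<close> is the pair of averages over \<open>[a, b]\<close>, which lies between the curve of the points
\<open>(s, 1/s)\<close> and its chord from \<open>(c, 1/c)\<close> to \<open>(d, 1/d)\<close>. The ray from the origin through \<open>(u, v)\<close> meets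
the chord at a point \<open>l (u, v)\<close> with \<open>l \<ge> 1\<close>, which divides the chord with weights \<open>\<theta>\<close> and
\<open>1 - \<theta>\<close>. Adding to \<open>[a, b]\<close> a mass \<open>e\<close> with values \<open>d\<close> and \<open>c\<close> in the proportion
\<open>\<theta> : 1 - \<theta>\<close> multiplies both averages by a factor of at least \<open>1\<close>. The mass \<open>e\<close> is chosen such that
either all the available mass \<open>a\<close> with value \<open>d\<close> is used up and \<open>lower\<close> applies, or all the available
mass \<open>1 - b\<close> with value \<open>c\<close> is used up and \<open>upper\<close> applies.
\<close>

lemma product_le_of_one_sided_bounds:
  fixes a b c d K u v :: real
  assumes ab: "0 < a" "a < b" "b < 1" and cd: "0 < c" "c \<le> d" and K: "1 \<le> K"
    and u: "c \<le> u" "u \<le> d" and uv: "c^2 * v \<le> u" "u \<le> d^2 * v" and chord: "u + c * d * v \<le> c + d"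
    and lower: "\<And>t. 0 < t \<Longrightarrow> t \<le> 1 \<Longrightarrow>
      (a * d + (b - a) * u + (t - b) * c) * (a / d + (b - a) * v + (t - b) / c) \<le> K * t^2"
    and upper: "\<And>t. 0 < t \<Longrightarrow> t \<le> 1 \<Longrightarrow>
      ((a - 1 + t) * d + (b - a) * u + (1 - b) * c) * ((a - 1 + t) / d + (b - a) * v + (1 - b) / c) \<le> K * t^2"
  shows "u * v \<le> K"
proof (cases "c = d")
  case True
  then have "u = c" "v \<le> 1 / c" using u uv cd by (auto simp: field_simps power2_eq_square)
  then have "u * v \<le> c * (1 / c)" using cd by (simp only:) (intro mult_left_mono, auto)
  then show ?thesis using K cd by simp
next
  case False
  then have cd': "c < d" "0 < d" using cd by auto
  have v0: "0 < v"
  proof -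
    have "0 < d^2 * v" using u uv cd by linarith
    then show ?thesis using cd' by (simp add: zero_less_mult_iff)
  qed
  have u0: "0 < u" using u cd by linarith
  define m where "m = b - a"
  have m: "0 < m" using ab by (simp add: m_def)
  define l where "l = (c + d) / (u + c * d * v)"
  have D: "0 < u + c * d * v" using u0 v0 cd cd' by (intro add_pos_pos mult_pos_pos) auto
  have l: "1 \<le> l" using chord D by (simp add: l_def)
  have lD: "l * (u + c * d * v) = c + d" using D by (simp add: l_def)
  define \<theta> where "\<theta> = (l * u - c) / (d - c)"
  have lu: "l * u = \<theta> * d + (1 - \<theta>) * c"
  proof -
    have "\<theta> * (d - c) = l * u - c" using cd' by (simp add: \<theta>_def)
    then show ?thesis by (simp add: algebra_simps)
  qed
  have lv: "l * v = \<theta> / d + (1 - \<theta>) / c"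
  proof -
    have "c * d * (l * v) = c + d - l * u" using lD by (simp add: algebra_simps)
    also have "\<dots> = \<theta> * c + (1 - \<theta>) * d" unfolding lu by (simp add: algebra_simps)
    finally show ?thesis using cd cd' by (simp add: field_simps)
  qed
  have scale: "u * v \<le> K" if e: "0 \<le> e" and le: "(m * u + e * (l * u)) * (m * v + e * (l * v)) \<le> K * (m + e)^2" for e
  proof -
    have "e * 1 \<le> e * l" using e l by (intro mult_left_mono)
    then have "(m + e)^2 \<le> (m + e * l)^2" using e m by (intro power_mono) auto
    then have "u * v * (m + e)^2 \<le> u * v * (m + e * l)^2" using u0 v0 by (intro mult_left_mono) auto
    also have "\<dots> = (m * u + e * (l * u)) * (m * v + e * (l * v))" by (simp add: algebra_simps power2_eq_square)
    also have "\<dots> \<le> K * (m + e)^2" by (rule le)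
    finally show ?thesis using e m by (simp add: mult_le_cancel_right)
  qed
  have \<theta>: "0 \<le> \<theta>" "\<theta> \<le> 1"
  proof -
    have "c * (u + c * d * v) \<le> (c + d) * u"
      using mult_left_mono[OF uv(1), of d] cd' by (simp add: algebra_simps power2_eq_square)
    then have "c \<le> l * u" using D by (simp add: l_def pos_le_divide_eq)
    then show "0 \<le> \<theta>" using cd' by (simp add: \<theta>_def)
    have "(c + d) * u \<le> d * (u + c * d * v)"
      using mult_left_mono[OF uv(2), of c] cd by (simp add: algebra_simps power2_eq_square)
    then have "l * u \<le> d" using D by (simp add: l_def pos_divide_le_eq)
    then show "\<theta> \<le> 1" using cd' by (simp add: \<theta>_def)
  qed
  show ?thesis
  proof (cases "a * (1 - \<theta>) \<le> (1 - b) * \<theta>")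
    case True
    have th: "0 < \<theta>"
    proof (rule ccontr)
      assume "\<not> 0 < \<theta>"
      then have "\<theta> = 0" using \<theta> by simp
      then show False using True ab by simp
    qed
    define e where "e = a / \<theta>"
    have e: "0 \<le> e" "e * \<theta> = a" using th ab by (auto simp: e_def)
    have t: "m + e \<le> 1"
    proof -
      have "e * (1 - \<theta>) \<le> 1 - b" using True th by (simp add: e_def pos_divide_le_eq)
      then show ?thesis using e(2) by (simp add: m_def algebra_simps)
    qed
    have f: "m + e - b = e * (1 - \<theta>)" using e(2) by (simp add: m_def algebra_simps)
    have "m * u + e * (l * u) = (e * \<theta>) * d + m * u + (e * (1 - \<theta>)) * c"
      "m * v + e * (l * v) = (e * \<theta>) / d + m * v + (e * (1 - \<theta>)) / c"
      unfolding lu lv by (simp_all add: algebra_simps)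
    then have "m * u + e * (l * u) = a * d + (b - a) * u + (m + e - b) * c"
      "m * v + e * (l * v) = a / d + (b - a) * v + (m + e - b) / c"
      unfolding e(2) f by (simp_all only: m_def)
    then show ?thesis using lower[of "m + e"] t m e by (intro scale[OF e(1)]) simp
  next
    case False
    have th: "0 < 1 - \<theta>"
    proof (rule ccontr)
      assume "\<not> 0 < 1 - \<theta>"
      then have "\<theta> = 1" using \<theta> by simp
      then show False using False ab by simp
    qed
    define e where "e = (1 - b) / (1 - \<theta>)"
    have e: "0 \<le> e" "e * (1 - \<theta>) = 1 - b" using th ab by (auto simp: e_def)
    have t: "m + e \<le> 1"
    proof -
      have "e * \<theta> \<le> a" using False th by (simp add: e_def pos_divide_le_eq)
      then show ?thesis using e(2) by (simp add: m_def algebra_simps)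
    qed
    have f: "a - 1 + (m + e) = e * \<theta>" using e(2) by (simp add: m_def algebra_simps)
    have "m * u + e * (l * u) = (e * \<theta>) * d + m * u + (e * (1 - \<theta>)) * c"
      "m * v + e * (l * v) = (e * \<theta>) / d + m * v + (e * (1 - \<theta>)) / c"
      unfolding lu lv by (simp_all add: algebra_simps)
    then have "m * u + e * (l * u) = (a - 1 + (m + e)) * d + (b - a) * u + (1 - b) * c"
      "m * v + e * (l * v) = (a - 1 + (m + e)) / d + (b - a) * v + (1 - b) / c"
      unfolding e(2) f by (simp_all only: m_def)
    then show ?thesis using upper[of "m + e"] t m e by (intro scale[OF e(1)]) simp
  qed
qed

text \<open>
The one-sided bounds for the weight truncated at \<open>c = g b\<close> and \<open>d = g a\<close> become the hypotheses of
\<open>product_le_of_one_sided_bounds\<close>, because the truncated rearrangement is \<open>d\<close> on \<open>(0, a]\<close>, \<open>g\<close> on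
\<open>[a, b]\<close> and \<open>c\<close> on \<open>[b, 1)\<close>.
\<close>

lemma interior_interval_bound:
  fixes \<phi> :: "real ^ 'n \<Rightarrow> real"
  assumes g: "is_monotonic_rearrangement \<phi> g" and A2: "\<phi> \<in> dyadic_A2 Q" and Q: "1 \<le> Q"
    and ab: "0 < a" "a < b" "b < 1"
  shows "integral {a..b} g * integral {a..b} (\<lambda>t. inverse (g t)) \<le> extension_constant CARD('n) Q * (b - a)^2"
proof -
  have \<phi>: "\<phi> \<in> borel_measurable (lebesgue_on unit_cube)" and pos: "AE x in lebesgue_on unit_cube. 0 < \<phi> x"
    using A2 by (auto simp: dyadic_A2_def)
  have int\<phi>: "integrable (lebesgue_on unit_cube) \<phi>" "integrable (lebesgue_on unit_cube) (\<lambda>x. inverse (\<phi> x))"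
    using A2 by (auto simp: dyadic_A2_def)
  have intg: "integrable (lebesgue_on {0..1}) g" "integrable (lebesgue_on {0..1}) (\<lambda>t. inverse (g t))"
    using rearrangement_integral(1)[OF g \<phi>, of "\<lambda>y. y"] rearrangement_integral(1)[OF g \<phi>, of inverse] int\<phi> by auto
  have HKg: "g integrable_on {a..b}" "(\<lambda>t. inverse (g t)) integrable_on {a..b}"
    using ab intg by (auto intro!: integrable_on_lebesgue_on integrable_lebesgue_on_subset[of "{0..1}" _ "{a..b}"])
  define c d where "c = g b" and "d = g a"
  have anti: "g t \<le> g s" if "0 < s" "s \<le> t" "t < 1" for s t
    using g that by (auto simp: is_monotonic_rearrangement_def monotone_on_def)
  have c: "0 < c" unfolding c_def by (rule rearrangement_everywhere[OF g \<phi> _ _ pos]) (use ab in auto)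
  have cd: "c \<le> d" using anti ab by (simp add: c_def d_def)
  have gab: "c \<le> g t \<and> g t \<le> d" if "t \<in> {a..b}" for t using that anti ab by (auto simp: c_def d_def)
  \<comment> \<open>written with reciprocals, \<open>clamp\<close> is composed of operations under which the dyadic class is stable\<close>
  define clamp where "clamp y = inverse (max (inverse d) (inverse (max c y)))" for y
  have clamp_eq: "clamp y = min d (max c y)" for y
  proof (cases "max c y \<le> d")
    case True
    then have "inverse d \<le> inverse (max c y)" using c by (intro le_imp_inverse_le) auto
    then show ?thesis using True by (simp add: clamp_def max_absorb2 min_absorb2)
  next
    case False
    then have le: "d \<le> max c y" by linarith
    then have "inverse (max c y) \<le> inverse d" using c cd by (intro le_imp_inverse_le) auto
    then show ?thesis using le by (simp only: clamp_def max_absorb1 min_absorb1 inverse_inverse_eq)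
  qed
  have cl: "(\<lambda>x. clamp (\<phi> x)) \<in> dyadic_A2 Q"
    unfolding clamp_def using c cd by (intro dyadic_A2_inverse dyadic_A2_truncate A2) auto
  have clb: "c \<le> clamp y" "clamp y \<le> d" "0 < clamp y" for y using c cd unfolding clamp_eq by auto
  have split: "average {0..1} (\<lambda>t. u (clamp (g t))) = a * u d + integral {a..b} (\<lambda>t. u (g t)) + (1 - b) * u c"
    if int: "integrable (lebesgue_on {0..1}) (\<lambda>t. u (clamp (g t)))" for u :: "real \<Rightarrow> real"
  proof -
    let ?F = "\<lambda>t. u (clamp (g t))"
    have HK: "?F integrable_on {0..1}" using int by (rule integrable_on_lebesgue_on) simp
    then have HK1: "?F integrable_on {a..1}" by (rule integrable_on_subinterval) (use ab in auto)
    have "average {0..1} ?F = integral {0..1} ?F" using average_eq_integral[OF int] by simp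
    also have "\<dots> = integral {0..a} ?F + (integral {a..b} ?F + integral {b..1} ?F)"
      using ab HK HK1 by (simp add: Henstock_Kurzweil_Integration.integral_combine)
    also have "integral {0..a} ?F = integral {0..a} (\<lambda>_. u d)"
    proof (rule integral_spike[of "{0}"])
      fix t assume "t \<in> {0..a} - {0}"
      then have "d \<le> g t" using anti[of t a] ab by (auto simp: d_def)
      then show "u d = ?F t" using cd by (simp add: clamp_eq)
    qed simp
    also have "integral {b..1} ?F = integral {b..1} (\<lambda>_. u c)"
    proof (rule integral_spike[of "{1}"])
      fix t assume "t \<in> {b..1} - {1}"
      then have "g t \<le> c" using anti[of b t] ab by (auto simp: c_def)
      then show "u c = ?F t" using cd by (simp add: clamp_eq)
    qed simp
    also have "integral {a..b} ?F = integral {a..b} (\<lambda>t. u (g t))"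
      using gab by (intro integral_cong) (auto simp: clamp_eq)
    finally show ?thesis using ab by simp
  qed
  have cm: "clamp \<in> borel_measurable borel" "(\<lambda>y. inverse (clamp y)) \<in> borel_measurable borel"
    unfolding clamp_def by measurable
  have intc: "integrable (lebesgue_on {0..1}) (\<lambda>t. clamp (g t))" "integrable (lebesgue_on {0..1}) (\<lambda>t. inverse (clamp (g t)))"
    using rearrangement_integral(1)[OF g \<phi> cm(1)] rearrangement_integral(1)[OF g \<phi> cm(2)] cl by (auto simp: dyadic_A2_def)
  define u v where "u = integral {a..b} g / (b - a)" and "v = integral {a..b} (\<lambda>t. inverse (g t)) / (b - a)"
  have uv: "integral {a..b} g = (b - a) * u" "integral {a..b} (\<lambda>t. inverse (g t)) = (b - a) * v"
    using ab by (simp_all add: u_def v_def)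
  have A: "average unit_cube (\<lambda>x. clamp (\<phi> x)) = a * d + (b - a) * u + (1 - b) * c"
    using rearrangement_integral(2)[OF g \<phi> cm(1)] split[of "\<lambda>y. y"] intc uv by simp
  have B: "average unit_cube (\<lambda>x. inverse (clamp (\<phi> x))) = a / d + (b - a) * v + (1 - b) / c"
    using rearrangement_integral(2)[OF g \<phi> cm(2)] split[of inverse] intc uv by (simp add: divide_inverse)
  have lin: "p * u + q * v \<le> w" if "\<And>y. c \<le> y \<Longrightarrow> y \<le> d \<Longrightarrow> p * y + q * inverse y \<le> w" for p q w
  proof -
    have "integral {a..b} (\<lambda>t. p * g t + q * inverse (g t)) \<le> integral {a..b} (\<lambda>_. w)"
      using that gab HKg by (intro integral_le integrable_add integrable_on_mult_right) auto
    moreover have "integral {a..b} (\<lambda>t. p * g t + q * inverse (g t)) = p * integral {a..b} g + q * integral {a..b} (\<lambda>t. inverse (g t))"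
      using HKg by (subst integral_add) (auto intro: integrable_on_mult_right)
    ultimately have "(b - a) * (p * u + q * v) \<le> (b - a) * w" using ab unfolding uv by (simp add: algebra_simps)
    then show ?thesis using ab by (simp add: mult_le_cancel_left)
  qed
  have "u * v \<le> extension_constant CARD('n) Q"
  proof (rule product_le_of_one_sided_bounds[OF ab c cd])
    show "1 \<le> extension_constant CARD('n) Q" using extension_constant_ge[OF Q, of "CARD('n)"] Q by linarith
    show "c \<le> u" using lin[of "-1" 0 "-c"] by simp
    show "u \<le> d" using lin[of 1 0 d] by simp
    have "-1 * u + c^2 * v \<le> 0"
    proof (rule lin)
      fix y assume y: "c \<le> y" "y \<le> d"
      then have "c^2 \<le> y^2" using c by (intro power_mono) auto
      then show "-1 * y + c^2 * inverse y \<le> 0" using c y by (simp add: field_simps power2_eq_square)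
    qed
    then show "c^2 * v \<le> u" by simp
    have "1 * u + (- (d^2)) * v \<le> 0"
    proof (rule lin)
      fix y assume y: "c \<le> y" "y \<le> d"
      then have "y^2 \<le> d^2" using c by (intro power_mono) auto
      then show "1 * y + (- (d^2)) * inverse y \<le> 0" using c y by (simp add: field_simps power2_eq_square)
    qed
    then show "u \<le> d^2 * v" by simp
    have "1 * u + (c * d) * v \<le> c + d"
    proof (rule lin)
      fix y assume y: "c \<le> y" "y \<le> d"
      then have "(y - c) * (y - d) \<le> 0" by (intro mult_nonneg_nonpos) auto
      then show "1 * y + (c * d) * inverse y \<le> c + d" using c y by (simp add: field_simps)
    qed
    then show "u + c * d * v \<le> c + d" by simp
  next
    fix t :: real assume t: "0 < t" "t \<le> 1"
    have "(a * d + (b - a) * u + (1 - b) * c - (1 - t) * c) * (a / d + (b - a) * v + (1 - b) / c - (1 - t) / c)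
      \<le> extension_constant CARD('n) Q * t^2"
      using dyadic_A2_bounded_below[OF cl Q c clb(1) t] unfolding A B .
    moreover have "a * d + (b - a) * u + (1 - b) * c - (1 - t) * c = a * d + (b - a) * u + (t - b) * c"
      by (simp add: algebra_simps)
    moreover have "a / d + (b - a) * v + (1 - b) / c - (1 - t) / c = a / d + (b - a) * v + (t - b) / c"
      by (simp add: diff_divide_distrib)
    ultimately show "(a * d + (b - a) * u + (t - b) * c) * (a / d + (b - a) * v + (t - b) / c)
      \<le> extension_constant CARD('n) Q * t^2" by simp
    have "(a * d + (b - a) * u + (1 - b) * c - (1 - t) * d) * (a / d + (b - a) * v + (1 - b) / c - (1 - t) / d)
      \<le> extension_constant CARD('n) Q * t^2"
      using dyadic_A2_bounded_above[OF cl Q clb(3) clb(2) t] unfolding A B .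
    moreover have "a * d + (b - a) * u + (1 - b) * c - (1 - t) * d = (a - 1 + t) * d + (b - a) * u + (1 - b) * c"
      by (simp add: algebra_simps)
    moreover have "a / d + (b - a) * v + (1 - b) / c - (1 - t) / d = (a - 1 + t) / d + (b - a) * v + (1 - b) / c"
      by (simp add: diff_divide_distrib add_divide_distrib)
    ultimately show "((a - 1 + t) * d + (b - a) * u + (1 - b) * c) * ((a - 1 + t) / d + (b - a) * v + (1 - b) / c)
      \<le> extension_constant CARD('n) Q * t^2" by simp
  qed
  then have "u * v * (b - a)^2 \<le> extension_constant CARD('n) Q * (b - a)^2" by (rule mult_right_mono) simp
  then show ?thesis unfolding uv by (simp only: power2_eq_square mult_ac)
qed

text \<open>
Intervals that reach an end point of \<open>[0, 1]\<close>, where \<open>g\<close> can be unbounded, are limits of interior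
intervals.
\<close>

lemma rearrangement_in_interval_A2:
  fixes \<phi> :: "real ^ 'n \<Rightarrow> real"
  assumes g: "is_monotonic_rearrangement \<phi> g" and A2: "\<phi> \<in> dyadic_A2 Q" and Q: "1 \<le> Q"
    and Q': "extension_constant CARD('n) Q \<le> Q'"
  shows "g \<in> interval_A2 Q'"
proof -
  have \<phi>: "\<phi> \<in> borel_measurable (lebesgue_on unit_cube)" and pos: "AE x in lebesgue_on unit_cube. 0 < \<phi> x"
    using A2 by (auto simp: dyadic_A2_def)
  have int\<phi>: "integrable (lebesgue_on unit_cube) \<phi>" "integrable (lebesgue_on unit_cube) (\<lambda>x. inverse (\<phi> x))"
    using A2 by (auto simp: dyadic_A2_def)
  have intg: "integrable (lebesgue_on {0..1}) g" "integrable (lebesgue_on {0..1}) (\<lambda>t. inverse (g t))"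
    using rearrangement_integral(1)[OF g \<phi>, of "\<lambda>y. y"] rearrangement_integral(1)[OF g \<phi>, of inverse] int\<phi> by auto
  have posg: "AE t in lebesgue_on {0..1}. 0 < g t" by (rule rearrangement_AE[OF g \<phi> _ pos]) simp
  show ?thesis unfolding interval_A2_def
  proof (intro CollectI conjI intg posg allI impI)
    fix a b :: real assume ab: "0 \<le> a" "a < b" "b \<le> 1"
    define h where "h t = inverse (g t)" for t
    define F where "F x = integral {0..x} g" for x
    define H where "H x = integral {0..x} h" for x
    have HK: "g integrable_on {0..1}" "h integrable_on {0..1}"
      using intg by (auto simp: h_def[abs_def] intro!: integrable_on_lebesgue_on)
    have cont: "continuous_on {0..1} F" "continuous_on {0..1} H"
      unfolding F_def H_def using HK by (auto intro: indefinite_integral_continuous_1)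
    have FH: "integral {s..t} g = F t - F s" "integral {s..t} h = H t - H s" if "0 \<le> s" "s \<le> t" "t \<le> 1" for s t
    proof -
      have i: "g integrable_on {0..t}" "h integrable_on {0..t}"
        using that by (auto intro: integrable_on_subinterval[OF HK(1)] integrable_on_subinterval[OF HK(2)])
      show "integral {s..t} g = F t - F s" "integral {s..t} h = H t - H s"
        using Henstock_Kurzweil_Integration.integral_combine[OF that(1,2) i(1)]
          Henstock_Kurzweil_Integration.integral_combine[OF that(1,2) i(2)]
        by (auto simp: F_def H_def)
    qed
    define \<alpha> where "\<alpha> n = a + (b - a) / real (n + 3)" for n
    define \<beta> where "\<beta> n = b - (b - a) / real (n + 3)" for n
    have lim0: "(\<lambda>n. (b - a) / real (n + 3)) \<longlonglongrightarrow> 0"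
      using LIMSEQ_ignore_initial_segment[OF lim_const_over_n[of "b - a"], of 3] by simp
    have \<alpha>: "\<alpha> \<longlonglongrightarrow> a" unfolding \<alpha>_def using tendsto_add[OF tendsto_const[of a] lim0] by simp
    have \<beta>: "\<beta> \<longlonglongrightarrow> b" unfolding \<beta>_def using tendsto_diff[OF tendsto_const[of b] lim0] by simp
    have \<alpha>\<beta>: "0 < \<alpha> n" "\<alpha> n < \<beta> n" "\<beta> n < 1" for n
    proof -
      define x where "x = (b - a) / real (n + 3)"
      have "0 < x" using ab by (simp add: x_def)
      moreover have "x \<le> (b - a) / 3" unfolding x_def using ab by (intro divide_left_mono) auto
      ultimately show "0 < \<alpha> n" "\<alpha> n < \<beta> n" "\<beta> n < 1"
        using ab unfolding \<alpha>_def \<beta>_def x_def[symmetric] by (simp_all add: field_simps)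
    qed
    have lim: "(\<lambda>n. f (s n)) \<longlonglongrightarrow> f l" if "continuous_on {0..1} f" "s \<longlonglongrightarrow> l" "l \<in> {0..1}" "\<And>n. s n \<in> {0..1}"
      for f s and l :: real
      using continuous_on_tendsto_compose[OF that(1,2,3)] that(4) by simp
    have m: "a \<in> {0..1}" "b \<in> {0..1}" using ab by auto
    have m': "\<alpha> n \<in> {0..1}" "\<beta> n \<in> {0..1}" for n using \<alpha>\<beta>[of n] by auto
    have "(F b - F a) * (H b - H a) \<le> extension_constant CARD('n) Q * (b - a)^2"
    proof (rule LIMSEQ_le)
      show "(\<lambda>n. (F (\<beta> n) - F (\<alpha> n)) * (H (\<beta> n) - H (\<alpha> n))) \<longlonglongrightarrow> (F b - F a) * (H b - H a)"
        by (intro tendsto_mult tendsto_diff lim[OF cont(1) \<alpha> m(1) m'(1)] lim[OF cont(1) \<beta> m(2) m'(2)]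
            lim[OF cont(2) \<alpha> m(1) m'(1)] lim[OF cont(2) \<beta> m(2) m'(2)])
      show "(\<lambda>n. extension_constant CARD('n) Q * (\<beta> n - \<alpha> n)^2) \<longlonglongrightarrow> extension_constant CARD('n) Q * (b - a)^2"
        using \<alpha> \<beta> by (intro tendsto_intros)
      have "(F (\<beta> n) - F (\<alpha> n)) * (H (\<beta> n) - H (\<alpha> n)) \<le> extension_constant CARD('n) Q * (\<beta> n - \<alpha> n)^2" for n
        using interior_interval_bound[OF g A2 Q \<alpha>\<beta>(1,2,3)[of n]] FH[of "\<alpha> n" "\<beta> n"] \<alpha>\<beta>[of n]
        by (simp add: h_def[abs_def])
      then show "\<exists>N. \<forall>n\<ge>N. (F (\<beta> n) - F (\<alpha> n)) * (H (\<beta> n) - H (\<alpha> n)) \<le> extension_constant CARD('n) Q * (\<beta> n - \<alpha> n)^2"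
        by blast
    qed
    also have "\<dots> \<le> Q' * (b - a)^2" using Q' by (intro mult_right_mono) auto
    finally have le: "integral {a..b} g * integral {a..b} h \<le> Q' * (b - a)^2" using FH ab by simp
    have i: "integrable (lebesgue_on {a..b}) g" "integrable (lebesgue_on {a..b}) h"
      using intg ab by (auto simp: h_def[abs_def] intro!: integrable_lebesgue_on_subset[of "{0..1}" _ "{a..b}"])
    have "average {a..b} g * average {a..b} h = integral {a..b} g * integral {a..b} h / (b - a)^2"
      using ab by (simp add: average_eq_integral[OF i(1)] average_eq_integral[OF i(2)] power2_eq_square)
    also have "\<dots> \<le> Q'" using le ab by (simp add: pos_divide_le_eq)
    finally show "average {a..b} g * average {a..b} (\<lambda>t. inverse (g t)) \<le> Q'" by (simp add: h_def[abs_def])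
  qed
qed

section \<open>A self-similar extremal weight\<close>

text \<open>
The corner cubes with vertex \<open>0\<close> and side \<open>2^-k\<close> decrease with \<open>k\<close>; for \<open>x\<close> in the interior of the
unit cube, \<open>shell x\<close> is the index of the last of them whose interior contains \<open>x\<close>. The value at \<open>0\<close>,
where no \<open>k\<close> qualifies, is unspecified.
\<close>

definition shell :: "real ^ 'n \<Rightarrow> nat" where
  "shell x = (LEAST k. \<exists>i. 1 \<le> x $ i * 2 ^ Suc k)"

lemma shell_ge:
  assumes "\<And>i. x $ i * 2 ^ m < 1" "\<And>i. 0 < x $ i"
  shows "m \<le> shell x"
proof (rule ccontr)
  assume "\<not> m \<le> shell x"
  then have m: "Suc (shell x) \<le> m" by simp
  have "\<exists>k. \<exists>i. 1 \<le> x $ i * 2 ^ Suc k"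
  proof -
    fix i
    obtain k where "1 / x $ i < 2 ^ k" using real_arch_pow[of 2 "1 / x $ i"] by auto
    then have "1 \<le> x $ i * 2 ^ Suc k" using assms(2)[of i] by (simp add: field_simps)
    then show ?thesis by blast
  qed
  then have "\<exists>i. 1 \<le> x $ i * 2 ^ Suc (shell x)" unfolding shell_def by (rule LeastI_ex)
  then obtain i where "1 \<le> x $ i * 2 ^ Suc (shell x)" by blast
  also have "\<dots> \<le> x $ i * 2 ^ m" using assms(2)[of i] m by (intro mult_left_mono power_increasing) auto
  finally show False using assms(1)[of i] by simp
qed

lemma shell_corner:
  assumes "x \<in> interior (dyadic_cube m (\<lambda>_. 0))"
  shows "m \<le> shell x"
proof (rule shell_ge)
  fix i
  have *: "0 < x $ i * 2 ^ m" "x $ i * 2 ^ m < 1" using assms unfolding mem_interior_dyadic_cube by simp_all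
  then show "x $ i * 2 ^ m < 1" "0 < x $ i" by (simp_all add: zero_less_mult_iff)
qed

lemma shell_eq:
  assumes x: "x \<in> interior (dyadic_cube (Suc m) (subcube (\<lambda>_. 0) e))" and e: "e i"
  shows "shell x = m"
proof -
  have *: "of_bool (e l) < x $ l * 2 ^ Suc m" "x $ l * 2 ^ Suc m < of_bool (e l) + (1::real)" for l
    using x[unfolded mem_interior_dyadic_cube subcube_def, rule_format, of l] by simp_all
  have ob: "0 \<le> (of_bool (e l) :: real)" "(of_bool (e l) :: real) \<le> 1" for l by simp_all
  have eq: "x $ l * 2 ^ Suc m = 2 * (x $ l * 2 ^ m)" for l by simp
  have "m \<le> shell x"
  proof (rule shell_ge)
    fix l
    have "0 < x $ l * 2 ^ m" "x $ l * 2 ^ m < 1" using *[of l] ob[of l] unfolding eq by linarith+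
    then show "x $ l * 2 ^ m < 1" "0 < x $ l" by (simp_all add: zero_less_mult_iff)
  qed
  moreover have "1 \<le> x $ i * 2 ^ Suc m" using *(1)[of i] e by simp
  then have "shell x \<le> m" unfolding shell_def by (intro Least_le exI[of _ i])
  ultimately show ?thesis by simp
qed

text \<open>
Going down the tree, a cube at the corner splits into a corner cube and cubes of one shell, and a cube
contained in a shell stays there.
\<close>

lemma shell_constant:
  fixes j :: "'n::finite \<Rightarrow> nat"
  assumes "\<forall>i. j i < 2 ^ k" "j \<noteq> (\<lambda>_. 0)"
  shows "\<exists>l. \<forall>x \<in> interior (dyadic_cube k j). shell x = l"
  using assms
proof (induction k arbitrary: j)
  case 0
  then have "j = (\<lambda>_. 0)" by (auto simp: fun_eq_iff)
  then show ?case using 0 by simp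
next
  case (Suc k)
  define j' where "j' i = j i div 2" for i
  define e where "e i = odd (j i)" for i
  have j: "j = subcube j' e"
  proof
    fix i
    show "j i = subcube j' e i" unfolding subcube_def j'_def e_def by (cases "even (j i)") auto
  qed
  have j': "\<forall>i. j' i < 2 ^ k"
  proof
    fix i
    have "j i < 2 ^ k * 2" using Suc.prems(1) by (simp add: mult.commute)
    then show "j' i < 2 ^ k" unfolding j'_def by (rule less_mult_imp_div_less)
  qed
  show ?case
  proof (cases "j' = (\<lambda>_. 0)")
    case True
    have "\<exists>i. e i"
    proof (rule ccontr)
      assume "\<not> (\<exists>i. e i)"
      then have "j = (\<lambda>_. 0)" unfolding j True by (simp add: subcube_def)
      then show False using Suc.prems(2) by contradiction
    qed
    then obtain i where i: "e i" ..
    show ?thesis unfolding j True by (intro exI[of _ k] ballI shell_eq[of _ k e i] i)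
  next
    case False
    then obtain l where l: "\<forall>x \<in> interior (dyadic_cube k j'). shell x = l" using Suc.IH[OF j'] by auto
    have "interior (dyadic_cube (Suc k) j) \<subseteq> interior (dyadic_cube k j')"
      unfolding j by (intro interior_mono subcube_subset)
    then have "\<forall>x \<in> interior (dyadic_cube (Suc k) j). shell x = l" using l by auto
    then show ?thesis by (rule exI)
  qed
qed

lemma has_integral_dyadic_cube_const:
  fixes f :: "real ^ 'n \<Rightarrow> real"
  assumes "\<And>x. x \<in> interior (dyadic_cube k j) \<Longrightarrow> f x = c"
  shows "(f has_integral c / (2 ^ CARD('n)) ^ k) (dyadic_cube k j)"
proof -
  have "measure lborel (dyadic_cube k j) = measure lebesgue (dyadic_cube k j)" by (simp add: dyadic_cube_def)
  then have "measure lborel (dyadic_cube k j) *\<^sub>R c = c / (2 ^ CARD('n)) ^ k" by (simp add: measure_dyadic_cube)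
  moreover have "(f has_integral measure lborel (dyadic_cube k j) *\<^sub>R c) (dyadic_cube k j)"
    using assms unfolding dyadic_cube_def interior_cbox
    by (intro has_integral_spike_interior[OF has_integral_const])
  ultimately show ?thesis by simp
qed

text \<open>
The integral over a corner cube is the integral over the next corner cube plus the contribution of one
shell. The right-hand side solves this recursion, which starts at \<open>m = M\<close>, where the truncated weight
is constant on the interior of the cube, and descends to smaller \<open>m\<close>.
\<close>

lemma truncated_shell_integral:
  fixes \<kappa> :: real
  assumes \<kappa>: "0 < \<kappa>" "\<kappa> < 2 ^ CARD('n)" and m: "m \<le> M"
  defines "N \<equiv> (2::real) ^ CARD('n)"
  shows "((\<lambda>x :: real ^ 'n. \<kappa> ^ min (shell x) M) has_integral
    (N - 1) / (N - \<kappa>) * (\<kappa> / N) ^ m + (1 - (N - 1) / (N - \<kappa>)) * (\<kappa> / N) ^ M) (dyadic_cube m (\<lambda>_. 0))"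
  using m
proof (induction m rule: inc_induct)
  case base
  have "((\<lambda>x :: real ^ 'n. \<kappa> ^ min (shell x) M) has_integral \<kappa> ^ M / N ^ M) (dyadic_cube M (\<lambda>_. 0))"
    unfolding N_def by (rule has_integral_dyadic_cube_const) (simp add: shell_corner min_absorb2)
  then show ?case by (simp add: power_divide algebra_simps)
next
  case (step m)
  define A where "A = (N - 1) / (N - \<kappa>)"
  define J where "J = A * (\<kappa> / N) ^ Suc m + (1 - A) * (\<kappa> / N) ^ M"
  let ?f = "\<lambda>x :: real ^ 'n. \<kappa> ^ min (shell x) M"
  let ?c = "\<lambda>e. dyadic_cube (Suc m) (subcube (\<lambda>_::'n. 0) e)"
  define I where "I e = (if e = (\<lambda>_. False) then J else \<kappa> ^ m / N ^ Suc m)" for e :: "'n \<Rightarrow> bool"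
  have N: "0 < N" "\<kappa> < N" using \<kappa> by (simp_all add: N_def)
  have int: "(?f has_integral I e) (?c e)" for e
  proof (cases "e = (\<lambda>_. False)")
    case True
    then have "subcube (\<lambda>_. 0) e = (\<lambda>_. 0)" by (simp add: subcube_def fun_eq_iff)
    then show ?thesis using step.IH True by (simp add: I_def J_def A_def)
  next
    case False
    then obtain i where i: "e i" by auto
    have "(?f has_integral \<kappa> ^ m / N ^ Suc m) (?c e)"
      unfolding N_def using step.hyps i
      by (intro has_integral_dyadic_cube_const) (simp add: shell_eq[of _ m e i] min_absorb1)
    then show ?thesis using False by (simp add: I_def)
  qed
  have card: "card (UNIV :: ('n \<Rightarrow> bool) set) = 2 ^ CARD('n)" by (simp add: card_fun)
  have "(?f has_integral (\<Sum>K\<in>range ?c. I (inv ?c K))) (dyadic_cube m (\<lambda>_. 0))"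
  proof (rule has_integral_combine_division[OF subcubes_division_of])
    fix K assume "K \<in> range ?c"
    then show "(?f has_integral I (inv ?c K)) K" using int by (auto simp: inv_f_f[OF inj_subcubes])
  qed
  moreover have "(\<Sum>K\<in>range ?c. I (inv ?c K)) = (\<Sum>e\<in>UNIV. I e)"
    by (simp add: sum.reindex[OF inj_subcubes] o_def inv_f_f[OF inj_subcubes])
  moreover have "(\<Sum>e\<in>UNIV. I e) = J + (N - 1) * (\<kappa> ^ m / N ^ Suc m)"
  proof -
    have "(\<Sum>e\<in>UNIV. I e) = I (\<lambda>_. False) + (\<Sum>e\<in>UNIV - {\<lambda>_. False}. I e)" by (rule sum.remove) auto
    also have "(\<Sum>e\<in>UNIV - {\<lambda>_. False}. I e) = (\<Sum>e\<in>UNIV - {\<lambda>_::'n. False}. \<kappa> ^ m / N ^ Suc m)"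
      by (intro sum.cong) (auto simp: I_def)
    also have "\<dots> = (N - 1) * (\<kappa> ^ m / N ^ Suc m)"
      by (simp add: card_Diff_singleton card N_def of_nat_diff)
    finally show ?thesis by (simp add: I_def)
  qed
  moreover have "J + (N - 1) * (\<kappa> ^ m / N ^ Suc m) = A * (\<kappa> / N) ^ m + (1 - A) * (\<kappa> / N) ^ M"
  proof -
    have "A * (N - \<kappa>) = N - 1" using N by (simp add: A_def)
    then have "A * \<kappa> + (N - 1) = A * N" by (simp add: algebra_simps)
    then have "(A * \<kappa> + (N - 1)) / N = A" using N by simp
    then have "A * (\<kappa> / N) + (N - 1) / N = A" by (simp add: add_divide_distrib)
    then have "(A * (\<kappa> / N) + (N - 1) / N) * (\<kappa> / N) ^ m = A * (\<kappa> / N) ^ m" by simp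
    then show ?thesis by (simp add: J_def power_divide algebra_simps)
  qed
  ultimately show ?case by (simp add: A_def)
qed

lemma shell_weight_integral:
  fixes \<kappa> :: real
  assumes \<kappa>: "0 < \<kappa>" "\<kappa> < 2 ^ CARD('n)"
  defines "N \<equiv> (2::real) ^ CARD('n)"
  shows "((\<lambda>x :: real ^ 'n. \<kappa> ^ shell x) has_integral (N - 1) / (N - \<kappa>) * (\<kappa> / N) ^ m) (dyadic_cube m (\<lambda>_. 0))"
proof -
  let ?S = "dyadic_cube m (\<lambda>_::'n. 0)"
  define f where "f M x = \<kappa> ^ min (shell x) (m + M)" for M and x :: "real ^ 'n"
  define c where "c M = (N - 1) / (N - \<kappa>) * (\<kappa> / N) ^ m + (1 - (N - 1) / (N - \<kappa>)) * (\<kappa> / N) ^ (m + M)" for M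
  have int: "(f M has_integral c M) ?S" for M
    using truncated_shell_integral[OF \<kappa>, of m "m + M"] by (simp add: f_def[abs_def] c_def N_def)
  have N: "0 < N" "\<kappa> < N" using \<kappa> by (simp_all add: N_def)
  have "(\<lambda>M. (\<kappa> / N) ^ (m + M)) \<longlonglongrightarrow> 0"
    using LIMSEQ_ignore_initial_segment[OF LIMSEQ_power_zero[of "\<kappa> / N"], of m] \<kappa> N by (simp add: add.commute)
  then have "c \<longlonglongrightarrow> (N - 1) / (N - \<kappa>) * (\<kappa> / N) ^ m + (1 - (N - 1) / (N - \<kappa>)) * 0"
    unfolding c_def by (intro tendsto_intros)
  then have c: "c \<longlonglongrightarrow> (N - 1) / (N - \<kappa>) * (\<kappa> / N) ^ m" by simp
  have lim: "(\<lambda>M. f M x) \<longlonglongrightarrow> \<kappa> ^ shell x" for x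
  proof (rule tendsto_eventually)
    show "\<forall>\<^sub>F M in sequentially. f M x = \<kappa> ^ shell x"
      using eventually_ge_at_top[of "shell x"] by eventually_elim (simp add: f_def min_absorb1)
  qed
  have intc: "(\<lambda>M. integral ?S (f M)) = c" by (rule ext) (rule integral_unique[OF int])
  have bounded: "bounded (range (\<lambda>M. integral ?S (f M)))"
    unfolding intc by (rule convergent_imp_bounded[OF c])
  have i: "f M integrable_on ?S" for M using int by blast
  have "(\<lambda>x. \<kappa> ^ shell x) integrable_on ?S \<and> (\<lambda>M. integral ?S (f M)) \<longlonglongrightarrow> integral ?S (\<lambda>x. \<kappa> ^ shell x)"
  proof (cases "1 \<le> \<kappa>")
    case True
    show ?thesis
      by (rule monotone_convergence_increasing[OF i _ lim bounded]) (use True in \<open>auto simp: f_def intro!: power_increasing\<close>)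
  next
    case False
    show ?thesis
      by (rule monotone_convergence_decreasing[OF i _ lim bounded]) (use False \<kappa> in \<open>auto simp: f_def intro!: power_decreasing\<close>)
  qed
  then have "(\<lambda>x. \<kappa> ^ shell x) integrable_on ?S" "c \<longlonglongrightarrow> integral ?S (\<lambda>x. \<kappa> ^ shell x)"
    unfolding intc by simp_all
  then show ?thesis using LIMSEQ_unique[OF c] by (simp add: has_integral_integrable_integral)
qed

lemma shell_weight_integrable:
  fixes \<kappa> :: real
  assumes \<kappa>: "0 < \<kappa>" "\<kappa> < 2 ^ CARD('n)"
  shows "integrable (lebesgue_on unit_cube) (\<lambda>x :: real ^ 'n. \<kappa> ^ shell x)"
proof -
  have "(\<lambda>x :: real ^ 'n. \<kappa> ^ shell x) integrable_on unit_cube"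
    using shell_weight_integral[OF \<kappa>, of 0] unfolding unit_cube_eq by blast
  then have "(\<lambda>x :: real ^ 'n. \<kappa> ^ shell x) absolutely_integrable_on unit_cube"
    using \<kappa> by (intro nonnegative_absolutely_integrable_1) auto
  then show ?thesis by (rule absolutely_integrable_imp_integrable) simp
qed

text \<open>
The weight is self-similar: from one corner cube to the next all its averages are multiplied by \<open>\<kappa>\<close>.
Therefore the product of the averages of \<open>\<kappa> ^ shell\<close> and of its reciprocal is the same on all corner
cubes.
\<close>

lemma shell_weight_average:
  fixes \<kappa> :: real
  assumes \<kappa>: "0 < \<kappa>" "\<kappa> < 2 ^ CARD('n)"
  shows "average (dyadic_cube m (\<lambda>_. 0)) (\<lambda>x :: real ^ 'n. \<kappa> ^ shell x)
    = (2 ^ CARD('n) - 1) / (2 ^ CARD('n) - \<kappa>) * \<kappa> ^ m"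
proof -
  have "integrable (lebesgue_on (dyadic_cube m (\<lambda>_. 0))) (\<lambda>x :: real ^ 'n. \<kappa> ^ shell x)"
    by (rule integrable_lebesgue_on_subset[OF shell_weight_integrable[OF \<kappa>] dyadic_cube_subset_unit])
      (auto simp: dyadic_cube_lebesgue)
  then have "average (dyadic_cube m (\<lambda>_. 0)) (\<lambda>x :: real ^ 'n. \<kappa> ^ shell x)
      = integral (dyadic_cube m (\<lambda>_. 0)) (\<lambda>x :: real ^ 'n. \<kappa> ^ shell x) * (2 ^ CARD('n)) ^ m"
    by (simp add: average_eq_integral dyadic_cube_lebesgue measure_dyadic_cube)
  then show ?thesis
    using integral_unique[OF shell_weight_integral[OF \<kappa>, of m]] by (simp add: power_divide)
qed

lemma shell_weight_in_dyadic_A2: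
  fixes \<kappa> Q :: real
  assumes \<kappa>: "1 \<le> \<kappa>" "\<kappa> < 2 ^ CARD('n)" and Q: "1 \<le> Q"
    and eq: "(2 ^ CARD('n) - 1) / (2 ^ CARD('n) - \<kappa>) * ((2 ^ CARD('n) - 1) / (2 ^ CARD('n) - inverse \<kappa>)) = Q"
  shows "(\<lambda>x :: real ^ 'n. \<kappa> ^ shell x) \<in> dyadic_A2 Q"
proof -
  have i: "0 < inverse \<kappa>" "inverse \<kappa> < 2 ^ CARD('n)"
  proof -
    have "inverse \<kappa> \<le> 1" using \<kappa> by (simp add: inverse_le_1_iff)
    then show "inverse \<kappa> < 2 ^ CARD('n)" using \<kappa> by linarith
  qed (use \<kappa> in simp)
  have \<kappa>0: "0 < \<kappa>" using \<kappa> by simp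
  have "average I (\<lambda>x. \<kappa> ^ shell x) * average I (\<lambda>x. inverse \<kappa> ^ shell x) \<le> Q"
    if I: "I \<in> dyadic_cubes" for I :: "(real ^ 'n) set"
  proof -
    obtain k j where kj: "I = dyadic_cube k j" "\<forall>i. j i < 2 ^ k" using I unfolding dyadic_cubes_eq by blast
    show ?thesis
    proof (cases "j = (\<lambda>_. 0)")
      case True
      have "average I (\<lambda>x. \<kappa> ^ shell x) * average I (\<lambda>x. inverse \<kappa> ^ shell x) = Q * (\<kappa> ^ k * inverse \<kappa> ^ k)"
        unfolding kj True shell_weight_average[OF \<kappa>0 \<kappa>(2)] shell_weight_average[OF i] eq[symmetric]
        by (simp only: mult_ac)
      also have "\<kappa> ^ k * inverse \<kappa> ^ k = 1" using \<kappa>0 by (simp add: power_mult_distrib[symmetric])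
      finally show ?thesis by simp
    next
      case False
      then obtain l where l: "\<And>x. x \<in> interior (dyadic_cube k j) \<Longrightarrow> shell x = l"
        using shell_constant[OF kj(2)] by blast
      have avg: "average I (\<lambda>x. \<rho> ^ shell x) = \<rho> ^ l" if \<rho>: "0 < \<rho>" "\<rho> < 2 ^ CARD('n)" for \<rho>
      proof -
        have "integrable (lebesgue_on I) (\<lambda>x. \<rho> ^ shell x)"
          by (rule integrable_lebesgue_on_subset[OF shell_weight_integrable[OF \<rho>]]) (use dyadic_cubesD[OF I] in auto)
        moreover have "((\<lambda>x. \<rho> ^ shell x) has_integral \<rho> ^ l / (2 ^ CARD('n)) ^ k) I"
          unfolding kj by (rule has_integral_dyadic_cube_const) (simp add: l)
        ultimately show ?thesis
          using dyadic_cubesD(2)[OF I] by (simp add: average_eq_integral integral_unique kj(1) measure_dyadic_cube)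
      qed
      have "average I (\<lambda>x. \<kappa> ^ shell x) * average I (\<lambda>x. inverse \<kappa> ^ shell x) = 1"
        unfolding avg[OF \<kappa>0 \<kappa>(2)] avg[OF i] using \<kappa>0 by (simp add: power_mult_distrib[symmetric])
      then show ?thesis using Q by simp
    qed
  qed
  then show ?thesis
    using shell_weight_integrable[OF \<kappa>0 \<kappa>(2)] shell_weight_integrable[OF i] \<kappa>0
    by (auto simp: dyadic_A2_def power_inverse)
qed

text \<open>
The product of the two averages is \<open>1\<close> for \<open>\<kappa> = 1\<close> and tends to infinity for \<open>\<kappa> \<rightarrow> N\<close>. The
intermediate value theorem is applied after clearing denominators.
\<close>

lemma ex_shell_ratio:
  fixes N Q :: real
  assumes N: "2 \<le> N" and Q: "1 \<le> Q"
  shows "\<exists>\<kappa>. 1 \<le> \<kappa> \<and> \<kappa> < N \<and> (N - 1) / (N - \<kappa>) * ((N - 1) / (N - inverse \<kappa>)) = Q"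
proof -
  define f where "f \<kappa> = (N - 1)^2 * \<kappa> - Q * ((N - \<kappa>) * (N * \<kappa> - 1))" for \<kappa>
  have "f 1 \<le> 0"
  proof -
    have "1 * (N - 1)^2 \<le> Q * (N - 1)^2" using Q by (intro mult_right_mono) auto
    then show ?thesis by (simp add: f_def power2_eq_square)
  qed
  moreover have fN: "0 < f N" using N by (simp add: f_def)
  moreover have "continuous_on {1..N} f" unfolding f_def by (intro continuous_intros)
  ultimately obtain \<kappa> where \<kappa>: "1 \<le> \<kappa>" "\<kappa> \<le> N" "f \<kappa> = 0" using IVT'[of f 1 0 N] N by auto
  then have "\<kappa> < N" using fN by (cases "\<kappa> = N") auto
  have "N * 1 \<le> N * \<kappa>" using \<kappa> N by (intro mult_left_mono) auto
  then have d: "0 < N * \<kappa> - 1" "0 < N - \<kappa>" "0 < \<kappa>" using N \<kappa> \<open>\<kappa> < N\<close> by linarith+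
  have "N - inverse \<kappa> = (N * \<kappa> - 1) / \<kappa>" using d by (simp add: field_simps)
  then have "(N - 1) / (N - \<kappa>) * ((N - 1) / (N - inverse \<kappa>)) = (N - 1)^2 * \<kappa> / ((N - \<kappa>) * (N * \<kappa> - 1))"
    by (simp add: power2_eq_square)
  also have "\<dots> = Q" using \<kappa>(3) d by (simp add: f_def divide_eq_eq)
  finally show ?thesis using \<kappa> \<open>\<kappa> < N\<close> by blast
qed

text \<open>
Here \<open>t = 2 / (N + 1)\<close> comes from the maximum in \<open>chord_product_bound\<close>: the point of \<open>[0, t]\<close> is
\<open>(1, 1) + (x - (1, 1)) / t\<close>, where \<open>x = (A, B)\<close> corresponds to the parameter \<open>1/N\<close>, so it corresponds
to the parameter \<open>1 / (N t) = (N + 1) / (2 N)\<close>.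
\<close>

lemma extremal_interval_product:
  fixes N \<kappa> Q :: real
  assumes N: "2 \<le> N" and \<kappa>: "1 \<le> \<kappa>" "\<kappa> < N"
  defines "A \<equiv> (N - 1) / (N - \<kappa>)" and "B \<equiv> (N - 1) / (N - inverse \<kappa>)" and "t \<equiv> 2 / (N + 1)"
  shows "((A - (1 - t)) / t) * ((B - (1 - t)) / t) = 1 + (A * B - 1) * (N + 1)^2 / (4 * N)"
proof -
  have "N * 1 \<le> N * \<kappa>" using \<kappa> N by (intro mult_left_mono) auto
  then have d: "0 < N * \<kappa> - 1" "0 < N - \<kappa>" "0 < \<kappa>" using N \<kappa> by linarith+
  define D where "D = (N - \<kappa>) * (N * \<kappa> - 1)"
  have D: "0 < D" using d by (simp add: D_def)
  have t: "(y - (1 - t)) / t = 1 + (y - 1) * (N + 1) / 2" for y using N by (simp add: t_def field_simps)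
  have "N - inverse \<kappa> = (N * \<kappa> - 1) / \<kappa>" using d by (simp add: field_simps)
  then have B: "B = (N - 1) * \<kappa> / (N * \<kappa> - 1)" by (simp add: B_def)
  have "(A - (1 - t)) / t = (N - 1) * (\<kappa> + 1) / (2 * (N - \<kappa>))" using d unfolding t A_def by (simp add: field_simps)
  moreover have "(B - (1 - t)) / t = (N - 1) * (\<kappa> + 1) / (2 * (N * \<kappa> - 1))" using d unfolding t B by (simp add: field_simps)
  ultimately have "((A - (1 - t)) / t) * ((B - (1 - t)) / t) = (N - 1)^2 * (\<kappa> + 1)^2 / (4 * D)"
  proof -
    assume *: "(A - (1 - t)) / t = (N - 1) * (\<kappa> + 1) / (2 * (N - \<kappa>))"
      "(B - (1 - t)) / t = (N - 1) * (\<kappa> + 1) / (2 * (N * \<kappa> - 1))"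
    have "2 * a * (2 * b) = 4 * (a * b)" for a b :: real by simp
    then have "2 * (N - \<kappa>) * (2 * (N * \<kappa> - 1)) = 4 * D" unfolding D_def .
    moreover have "(N - 1) * (\<kappa> + 1) * ((N - 1) * (\<kappa> + 1)) = (N - 1)^2 * (\<kappa> + 1)^2" by (simp only: power2_eq_square mult_ac)
    ultimately show ?thesis unfolding * times_divide_times_eq by simp
  qed
  moreover have "A * B = (N - 1)^2 * \<kappa> / D" by (simp add: A_def B D_def power2_eq_square mult_ac)
  moreover have "(N - 1)^2 * (\<kappa> + 1)^2 / (4 * D) = 1 + ((N - 1)^2 * \<kappa> / D - 1) * (N + 1)^2 / (4 * N)"
  proof -
    have "N * ((N - 1)^2 * (\<kappa> + 1)^2) = 4 * N * D + ((N - 1)^2 * \<kappa> - D) * (N + 1)^2"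
      unfolding D_def by (simp add: algebra_simps power2_eq_square)
    moreover have "X / (4 * D) = 1 + (Y / D - 1) * Z / (4 * N)" if "N * X = 4 * N * D + (Y - D) * Z" for X Y Z
      using that D N by (simp add: field_simps)
    ultimately show ?thesis by blast
  qed
  ultimately show ?thesis by simp
qed

text \<open>
The weight is \<open>1\<close> outside the corner cube of measure \<open>1/N\<close> and at least \<open>1\<close> inside, so its
rearrangement is \<open>1\<close> on \<open>(1/N, 1)\<close>. The integrals over \<open>[0, t]\<close> for \<open>t = 2 / (N + 1) > 1/N\<close> follow by
subtraction, without computing the rearrangement.
\<close>

lemma extension_constant_necessary:
  fixes Q Q' :: real
  assumes Q: "1 \<le> Q" and all: "\<And>\<phi> :: real ^ 'n \<Rightarrow> real. \<phi> \<in> dyadic_A2 Q \<Longrightarrow> monotonic_rearrangement \<phi> \<in> interval_A2 Q'"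
  shows "extension_constant CARD('n) Q \<le> Q'"
proof -
  define N where "N = (2::real) ^ CARD('n)"
  have "(2::real) ^ 1 \<le> 2 ^ CARD('n)" by (intro power_increasing) (auto simp: Suc_le_eq)
  then have N: "2 \<le> N" by (simp add: N_def)
  obtain \<kappa> where \<kappa>: "1 \<le> \<kappa>" "\<kappa> < N" "(N - 1) / (N - \<kappa>) * ((N - 1) / (N - inverse \<kappa>)) = Q"
    using ex_shell_ratio[OF N Q] by blast
  define \<phi> where "\<phi> x = \<kappa> ^ shell x" for x :: "real ^ 'n"
  have \<phi>: "\<phi> \<in> dyadic_A2 Q"
    unfolding \<phi>_def using shell_weight_in_dyadic_A2[where 'n='n, of \<kappa> Q] \<kappa> Q by (simp add: N_def)
  define A B where "A = (N - 1) / (N - \<kappa>)" and "B = (N - 1) / (N - inverse \<kappa>)"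
  have \<kappa>0: "0 < \<kappa>" "0 < inverse \<kappa>" "inverse \<kappa> < N"
    using \<kappa> N by (auto intro: le_less_trans[of "inverse \<kappa>" 1 N] simp: inverse_le_1_iff)
  have \<phi>m: "\<phi> \<in> borel_measurable (lebesgue_on unit_cube)" using \<phi> by (auto simp: dyadic_A2_def)
  have avg: "average unit_cube \<phi> = A" "average unit_cube (\<lambda>x. inverse (\<phi> x)) = B"
    using shell_weight_average[where 'n='n, of \<kappa> 0] shell_weight_average[where 'n='n, of "inverse \<kappa>" 0] \<kappa>0 \<kappa>
    by (simp_all add: \<phi>_def[abs_def] power_inverse A_def B_def N_def unit_cube_eq)
  define g where "g = monotonic_rearrangement \<phi>"
  have g: "is_monotonic_rearrangement \<phi> g"
    unfolding g_def by (rule is_monotonic_rearrangement_monotonic_rearrangement[OF \<phi>m])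
  have gI: "g \<in> interval_A2 Q'" unfolding g_def by (rule all[OF \<phi>])
  have ge: "1 \<le> g s" if "0 < s" "s < 1" for s
    by (rule rearrangement_everywhere[OF g \<phi>m _ _ _ that]) (use \<kappa> in \<open>auto simp: \<phi>_def one_le_power\<close>)
  have le: "g s \<le> 1" if s: "1 / N < s" "s < 1" for s
  proof (rule ccontr)
    assume "\<not> g s \<le> 1"
    then have s1: "1 < g s" by simp
    have gm: "g \<in> borel_measurable (lebesgue_on {0..1})"
      and d: "distr (lebesgue_on {0..1}) borel g = distr (lebesgue_on unit_cube) borel \<phi>"
      using g by (auto simp: is_monotonic_rearrangement_def)
    have "0 < 1 / N" using N by simp
    then have s0: "0 < s" using s by linarith
    have "{0<..s} \<subseteq> g -` {1<..} \<inter> {0..1}"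
    proof
      fix r assume "r \<in> {0<..s}"
      then have "g s \<le> g r" using g s by (auto simp: is_monotonic_rearrangement_def monotone_on_def)
      then show "r \<in> g -` {1<..} \<inter> {0..1}" using s1 s \<open>r \<in> {0<..s}\<close> by auto
    qed
    moreover have "g -` {1<..} \<inter> {0..1} \<in> sets lebesgue"
      using measurable_sets[OF gm, of "{1<..}"] by (simp add: sets_restrict_space_iff space_restrict_space)
    ultimately have "emeasure lebesgue {0<..s} \<le> emeasure lebesgue (g -` {1<..} \<inter> {0..1})" by (rule emeasure_mono)
    also have "\<dots> = emeasure (distr (lebesgue_on {0..1}) borel g) {1<..}"
      using gm by (simp add: emeasure_distr emeasure_restrict_space space_restrict_space)
    also have "\<dots> = emeasure (lebesgue_on unit_cube) (\<phi> -` {1<..} \<inter> space (lebesgue_on unit_cube))"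
      unfolding d using \<phi>m by (simp add: emeasure_distr)
    also have "\<dots> = emeasure lebesgue (\<phi> -` {1<..} \<inter> unit_cube)"
      by (simp add: emeasure_restrict_space space_restrict_space)
    also have "\<dots> \<le> emeasure lebesgue (dyadic_cube 1 (\<lambda>_::'n. 0))"
    proof (rule emeasure_mono)
      show "\<phi> -` {1<..} \<inter> unit_cube \<subseteq> dyadic_cube 1 (\<lambda>_. 0)"
      proof
        fix x assume x: "x \<in> \<phi> -` {1<..} \<inter> unit_cube"
        then have "shell x \<noteq> 0" by (cases "shell x = 0") (auto simp: \<phi>_def)
        then have "\<not> (\<exists>i. 1 \<le> x $ i * 2 ^ Suc 0)" unfolding shell_def by (metis (mono_tags, lifting) Least_le le_zero_eq)
        then show "x \<in> dyadic_cube 1 (\<lambda>_. 0)" using x by (auto simp: mem_dyadic_cube mem_box_cart not_le less_imp_le)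
      qed
    qed (rule dyadic_cube_lebesgue)
    also have "\<dots> = ennreal (1 / N)"
    proof -
      have "dyadic_cube 1 (\<lambda>_::'n. 0) \<in> lmeasurable" by (simp add: dyadic_cube_def)
      from emeasure_eq_measure2[OF this] show ?thesis unfolding measure_dyadic_cube by (simp add: N_def)
    qed
    finally show False using s s0 \<open>0 < 1 / N\<close> by simp
  qed
  define t where "t = 2 / (N + 1)"
  have t: "1 / N < t" "0 < t" "t < 1" using N by (auto simp: t_def field_simps)
  have g1: "g s = 1" if "t \<le> s" "s < 1" for s using that t ge[of s] le[of s] by linarith
  have head: "average {0..t} (\<lambda>s. u (g s)) = (average {0..1} (\<lambda>s. u (g s)) - (1 - t)) / t"
    if int: "integrable (lebesgue_on {0..1}) (\<lambda>s. u (g s))" and u: "u 1 = 1" for u :: "real \<Rightarrow> real"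
  proof -
    let ?F = "\<lambda>s. u (g s)"
    have HK: "?F integrable_on {0..1}" using int by (rule integrable_on_lebesgue_on) simp
    have "integral {t..1} ?F = integral {t..1} (\<lambda>_. 1)"
      by (rule integral_spike[of "{1}"]) (use g1 u in auto)
    then have "integral {t..1} ?F = 1 - t" using t by simp
    moreover have "integral {0..t} ?F + integral {t..1} ?F = integral {0..1} ?F"
      using t HK by (intro Henstock_Kurzweil_Integration.integral_combine) auto
    moreover have "average {0..1} ?F = integral {0..1} ?F" using average_eq_integral[OF int] by simp
    moreover have "average {0..t} ?F = integral {0..t} ?F / t"
      using t average_eq_integral[OF integrable_lebesgue_on_subset[OF int, of "{0..t}"]] by simp
    ultimately show ?thesis by (simp add: algebra_simps)
  qed
  have "integrable (lebesgue_on {0..1}) g" "integrable (lebesgue_on {0..1}) (\<lambda>s. inverse (g s))"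
    and b: "average {0..t} g * average {0..t} (\<lambda>s. inverse (g s)) \<le> Q'"
    using gI t by (auto simp: interval_A2_def)
  then have "average {0..t} g = (A - (1 - t)) / t" "average {0..t} (\<lambda>s. inverse (g s)) = (B - (1 - t)) / t"
    using head[of "\<lambda>y. y"] head[of inverse] avg
      rearrangement_integral(2)[OF g \<phi>m, of "\<lambda>y. y"] rearrangement_integral(2)[OF g \<phi>m, of inverse] by auto
  then have "((A - (1 - t)) / t) * ((B - (1 - t)) / t) \<le> Q'" using b by simp
  then show ?thesis
    using extremal_interval_product[OF N \<kappa>(1,2)] \<kappa>(3)
    unfolding A_def B_def t_def by (simp add: extension_constant_def N_def)
qed

section \<open>The rearrangement theorem\<close>

theorem corollary2:
  fixes Q Q' :: real
  assumes "Q \<ge> 1"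
  shows "(\<forall>\<phi> \<in> (dyadic_A2 Q :: (real ^ 'n \<Rightarrow> real) set). monotonic_rearrangement \<phi> \<in> interval_A2 Q')
    \<longleftrightarrow> Q' \<ge> (Q * (2 ^ CARD('n) + 1)^2 - (2 ^ CARD('n) - 1)^2) / 2 ^ (CARD('n) + 2)"
proof -
  have "(Q * (2 ^ CARD('n) + 1)^2 - (2 ^ CARD('n) - 1)^2) / 2 ^ (CARD('n) + 2) = extension_constant CARD('n) Q"
    by (rule extension_constant_eq[symmetric])
  moreover have "monotonic_rearrangement \<phi> \<in> interval_A2 Q'"
    if "extension_constant CARD('n) Q \<le> Q'" "\<phi> \<in> dyadic_A2 Q" for \<phi> :: "real ^ 'n \<Rightarrow> real"
  proof -
    have "\<phi> \<in> borel_measurable (lebesgue_on unit_cube)" using that(2) by (auto simp: dyadic_A2_def)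
    then show ?thesis
      using rearrangement_in_interval_A2 is_monotonic_rearrangement_monotonic_rearrangement that assms by blast
  qed
  ultimately show ?thesis using extension_constant_necessary[OF assms] by auto
qed

end
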